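(* Let $G:\mathbb{R}^{m+n}\to\mathbb{R}^d$ be a $\mathcal{C}^1$ mapping, let $M:\mathbb{R}^{m+n}\rightrightarrows\mathbb{R}^d$ be a multifunction with closed graph, and let $S:\mathbb{R}^m\rightrightarrows\mathbb{R}^n$ be $$S(w)=\{x\in\mathbb{R}^n\mid 0\in G(w,x)+M(w,x)\}.$$ Let $W\subseteq\operatorname{dom} S$ be a closed set and $(\bar w,\bar x)\in\operatorname{gph} S|_W$. Put $$\mathcal{M}(w,x,y):=\nabla G(w,x)^*y+D^*M|_{W\times\mathbb{R}^n}\big((w,x)\mid -G(w,x)\big)(y)\subseteq\mathbb{R}^m\times\mathbb{R}^n .$$ (1) If the basic constraint qualification $$(0,0)\in\mathcal{M}(\bar w,\bar x,y)\ \Longrightarrow\ y=0$$ holds, then for every $r\in\mathbb{R}^n$ $$D^*_WS(\bar w\mid\bar x)(r)\subseteq R_1(r):=\limsup_{\substack{(w,x)\to(\bar w,\bar x),\ (w,x)\in\operatorname{gph} S|_W\\ r'\to r}}\ \bigcup_{y\in\mathbb{R}^d}\Big\{\operatorname{proj}_{T_W(w)}(v)\ \Big|\ (v,-r')\in\mathcal{M}(w,x,y)\Big\}.$$ (2) If the strong constraint qualification $$(0,0)\in\limsup_{\substack{(w,x)\to(\bar w,\bar x),\ (w,x)\in\operatorname{gph} S|_W\\ y'\to y}}\operatorname{proj}_{T_W(w)\times\mathbb{R}^n}\mathcal{M}(w,x,y')\ \Longrightarrow\ y=0$$ holds, then the limsup can equivalently be put inside the bracket: for every $r\in\mathbb{R}^n$,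 $R_1(r)$ coincides with $$R_2(r):=\Big\{t\in\mathbb{R}^m\ \Big|\ \exists\,y\in\mathbb{R}^d:\ (t,-r)\in\limsup_{\substack{(w,x,-G(w,x))\to(\bar w,\bar x,-G(\bar w,\bar x))\\ (w,x,-G(w,x))\in\operatorname{gph} M|_{W\times\mathbb{R}^n},\ y'\to y}}\operatorname{proj}_{T_W(w)\times\mathbb{R}^n}\mathcal{M}(w,x,y')\Big\},$$ and $D^*_WS(\bar w\mid\bar x)(r)\subseteq R_2(r)$. (3) If, in addition to the strong constraint qualification in (2), $M|_{W\times\mathbb{R}^n}$ is graphically regular at $(\bar w,\bar x,-G(\bar w,\bar x))$ and $W$ is a smooth manifold around $\bar w$, then for every $r\in\mathbb{R}^n$ $$D^*_WS(\bar w\mid\bar x)(r)=\Big\{t\in\mathbb{R}^m\ \Big|\ \exists\,y\in\mathbb{R}^d:\ (t,-r)\in\operatorname{proj}_{T_W(\bar w)\times\mathbb{R}^n}\mathcal{M}(\bar w,\bar x,y)\Big\}.$$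
   Context: For a multifunction $F$: $\operatorname{gph}F=\{(x,u)\mid u\in F(x)\}$, $\operatorname{dom}F=\{x\mid F(x)\neq\emptyset\}$; the restriction $F|_X(x)$ equals $F(x)$ if $x\in X$ and $\emptyset$ otherwise. $\nabla G(w,x)^*$ is the transpose of the Jacobian of $G$. $\limsup$ of sets is the outer limit. For $C\subset\mathbb{R}^n$ and $x\in C$: $T_C(x)$ is the contingent cone ($w$ such that $x+t_kw_k\in C$ for some $t_k\searrow0$, $w_k\to w$); $\widehat N_C(x)$ is the polar of $T_C(x)$; $N_C(x)$ is the limiting normal cone (limits of $v_k\in\widehat N_C(x_k)$, $x_k\to x$ in $C$). All are empty for $x\notin C$. $C$ is regular at $x$ if it is locally closed there and $\widehat N_C(x)=N_C(x)$; a multifunction is graphically regular at a point of its graph if its graph is regular there. Coderivative: $x^*\in D^*F(\bar x\mid\bar u)(u^* )$ iff $(x^*,-u^* )\in N_{\operatorname{gph}F}(\bar x,\bar u)$. Projections: $\operatorname{proj}_C(x)=\{y\in C\mid\|y-x\|=d(x,C)\}$ (possibly multivalued), $\operatorname{proj}_CZ=\bigcup_{z\in Z}\operatorname{proj}_C(z)$; $\{\operatorname{proj}_C(v)\mid\dots\}$ denotes the union of the sets $\operatorname{proj}_C(v)$ over the indicated $v$. Projectional coderivative of $F:\mathbb{R}^p\rightrightarrows\mathbb{R}^s$ at $\bar x\in X\subseteq\mathbb{R}^p$ for $\bar u\in F(\bar x)$ with respect to $X$: $t^*\in D^*_XF(\bar x\mid\bar u)(u^* )$ iff $$(t^*,-u^*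 )\in\limsup_{(x,u)\to(\bar x,\bar u),\ (x,u)\in\operatorname{gph}F|_X}\operatorname{proj}_{T_X(x)\times\mathbb{R}^s}N_{\operatorname{gph}F|_X}(x,u).$$ $W\subset\mathbb{R}^m$ is a ($d'$-dimensional) smooth manifold around $\bar w\in W$ if there are an open neighborhood $O$ of $\bar w$ and a $\mathcal{C}^1$ mapping $\Phi:O\to\mathbb{R}^{m-d'}$ with $\nabla\Phi(\bar w)$ of full rank $m-d'$ and $W\cap O=\{w\in O\mid\Phi(w)=0\}$. *)

theory Defs
  imports "HOL-Analysis.Analysis"
begin

section \<open>Multifunctions\<close>

definition gph :: "('a \<Rightarrow> 'b set) \<Rightarrow> ('a \<times> 'b) set" where
  "gph F = {(x, u). u \<in> F x}"

definition mdom :: "('a \<Rightarrow> 'b set) \<Rightarrow> 'a set" where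
  "mdom F = {x. F x \<noteq> {}}"

definition mrestrict :: "('a \<Rightarrow> 'b set) \<Rightarrow> 'a set \<Rightarrow> 'a \<Rightarrow> 'b set" where
  "mrestrict F X x = (if x \<in> X then F x else {})"

text \<open>
  The outer limit of \<open>A z\<close> as \<open>z\<close> tends to \<open>zbar\<close> through \<open>D\<close>. As usual in variational
  analysis, \<open>z = zbar\<close> is allowed. A limit superior over several variables is an outer
  limit over tuples; a variable that ranges freely contributes the factor \<open>UNIV\<close> to \<open>D\<close>.
\<close>

definition outer_limit ::
  "'a::topological_space set \<Rightarrow> 'a \<Rightarrow> ('a \<Rightarrow> 'b::topological_space set) \<Rightarrow> 'b set" where
  "outer_limit D zbar A =
     {u. \<exists>z v. (\<forall>k::nat. z k \<in> D \<and> v k \<in> A (z k)) \<and> z \<longlonglongrightarrow> zbar \<and> v \<longlonglongrightarrow> u}"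

section \<open>Tangent and normal cones\<close>

text \<open>The notation \<open>t\<^sub>k \<searrow> 0\<close> is read as \<open>t\<^sub>k \<rightarrow> 0\<close> with \<open>t\<^sub>k > 0\<close>.\<close>

definition tangent_cone :: "'a::euclidean_space set \<Rightarrow> 'a \<Rightarrow> 'a set" where
  "tangent_cone C x =
     {w. x \<in> C \<and> (\<exists>t w'. (\<forall>k::nat. 0 < t k \<and> x + t k *\<^sub>R w' k \<in> C) \<and>
                        t \<longlonglongrightarrow> 0 \<and> w' \<longlonglongrightarrow> w)}"

definition regular_normal_cone :: "'a::euclidean_space set \<Rightarrow> 'a \<Rightarrow> 'a set" where
  "regular_normal_cone C x = {v. x \<in> C \<and> (\<forall>w\<in>tangent_cone C x. v \<bullet> w \<le> 0)}"

definition normal_cone :: "'a::euclidean_space set \<Rightarrow> 'a \<Rightarrow> 'a set" where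
  "normal_cone C x = {v. x \<in> C \<and> v \<in> outer_limit C x (regular_normal_cone C)}"

definition locally_closed_at :: "'a::euclidean_space set \<Rightarrow> 'a \<Rightarrow> bool" where
  "locally_closed_at C x \<longleftrightarrow> (\<exists>V. closed V \<and> x \<in> interior V \<and> closed (C \<inter> V))"

definition regular_at :: "'a::euclidean_space set \<Rightarrow> 'a \<Rightarrow> bool" where
  "regular_at C x \<longleftrightarrow>
     x \<in> C \<and> locally_closed_at C x \<and> regular_normal_cone C x = normal_cone C x"

definition graphically_regular_at ::
  "('a::euclidean_space \<Rightarrow> 'b::euclidean_space set) \<Rightarrow> 'a \<Rightarrow> 'b \<Rightarrow> bool" where
  "graphically_regular_at F x u \<longleftrightarrow> regular_at (gph F) (x, u)"

section \<open>Projections and coderivatives\<close>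

definition proj :: "'a::euclidean_space set \<Rightarrow> 'a \<Rightarrow> 'a set" where
  "proj C x = {y \<in> C. norm (y - x) = infdist x C}"

definition proj_set :: "'a::euclidean_space set \<Rightarrow> 'a set \<Rightarrow> 'a set" where
  "proj_set C Z = (\<Union>z\<in>Z. proj C z)"

definition coderivative ::
  "('a::euclidean_space \<Rightarrow> 'b::euclidean_space set) \<Rightarrow> 'a \<Rightarrow> 'b \<Rightarrow> 'b \<Rightarrow> 'a set" where
  "coderivative F x u us = {xs. (xs, - us) \<in> normal_cone (gph F) (x, u)}"

definition projectional_coderivative ::
  "'a::euclidean_space set \<Rightarrow> ('a \<Rightarrow> 'b::euclidean_space set) \<Rightarrow> 'a \<Rightarrow> 'b \<Rightarrow> 'b \<Rightarrow> 'a set" where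
  "projectional_coderivative X F xbar ubar us =
     {ts. (ts, - us) \<in> outer_limit (gph (mrestrict F X)) (xbar, ubar)
            (\<lambda>(x, u). proj_set (tangent_cone X x \<times> UNIV) (normal_cone (gph (mrestrict F X)) (x, u)))}"

section \<open>Smoothness\<close>

definition C1_on :: "'a::euclidean_space set \<Rightarrow> ('a \<Rightarrow> 'b::euclidean_space) \<Rightarrow> bool" where
  "C1_on U f \<longleftrightarrow>
     (\<exists>f' :: 'a \<Rightarrow> 'a \<Rightarrow>\<^sub>L 'b.
        (\<forall>x\<in>U. (f has_derivative blinfun_apply (f' x)) (at x)) \<and> continuous_on U f')"

text \<open>
  The codimension \<open>m - d'\<close> is a number, possibly \<open>0\<close>, and not a type, so the space of
  dimension \<open>m - d'\<close> is represented as the coordinate subspace of \<open>real ^ 'm\<close> whose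
  coordinates outside an index set \<open>I\<close> with \<open>card I = m - d'\<close> vanish. The rows that this
  adds to the Jacobian are zero, so they do not affect its rank.
\<close>

definition smooth_manifold_around :: "nat \<Rightarrow> (real ^ 'm) set \<Rightarrow> real ^ 'm \<Rightarrow> bool" where
  "smooth_manifold_around d' W wbar \<longleftrightarrow>
     d' \<le> CARD('m) \<and> wbar \<in> W \<and>
     (\<exists>(I :: 'm set) U (\<Phi> :: real ^ 'm \<Rightarrow> real ^ 'm).
        card I = CARD('m) - d' \<and> open U \<and> wbar \<in> U \<and> C1_on U \<Phi> \<and>
        (\<forall>w\<in>U. \<forall>i. i \<notin> I \<longrightarrow> \<Phi> w $ i = 0) \<and>
        rank (matrix (frechet_derivative \<Phi> (at wbar))) = CARD('m) - d' \<and>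
        W \<inter> U = {w \<in> U. \<Phi> w = 0})"

section \<open>Parametric generalized equations\<close>

definition sol_map ::
  "('a \<times> 'b \<Rightarrow> 'c::ab_group_add) \<Rightarrow> ('a \<times> 'b \<Rightarrow> 'c set) \<Rightarrow> 'a \<Rightarrow> 'b set" where
  "sol_map G M w = {x. 0 \<in> (\<lambda>z. G (w, x) + z) ` M (w, x)}"

text \<open>The transpose of the Jacobian is the adjoint of the derivative.\<close>

definition normal_map ::
  "('a::euclidean_space \<times> 'b::euclidean_space \<Rightarrow> 'c::euclidean_space) \<Rightarrow>
   ('a \<times> 'b \<Rightarrow> 'c set) \<Rightarrow> 'a set \<Rightarrow> 'a \<Rightarrow> 'b \<Rightarrow> 'c \<Rightarrow> ('a \<times> 'b) set" where
  "normal_map G M W w x y =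
     (\<lambda>z. adjoint (frechet_derivative G (at (w, x))) y + z) `
       coderivative (mrestrict M (W \<times> UNIV)) (w, x) (- G (w, x)) y"

text \<open>
  The two candidate upper estimates of the projectional coderivative of \<open>sol_map G M\<close>, written
  \<open>R\<^sub>1\<close> and \<open>R\<^sub>2\<close>: in \<open>upper_outer\<close> the limit is taken over the union in \<open>y\<close>, in \<open>upper_inner\<close>
  it is taken for each \<open>y\<close> separately.
\<close>

definition upper_outer ::
  "('a::euclidean_space \<times> 'b::euclidean_space \<Rightarrow> 'c::euclidean_space) \<Rightarrow>
   ('a \<times> 'b \<Rightarrow> 'c set) \<Rightarrow> 'a set \<Rightarrow> 'a \<Rightarrow> 'b \<Rightarrow> 'b \<Rightarrow> 'a set" where
  "upper_outer G M W wbar xbar r =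
     outer_limit (gph (mrestrict (sol_map G M) W) \<times> UNIV) ((wbar, xbar), r)
       (\<lambda>((w, x), r'). \<Union>y. proj_set (tangent_cone W w) {v. (v, - r') \<in> normal_map G M W w x y})"

definition upper_inner ::
  "('a::euclidean_space \<times> 'b::euclidean_space \<Rightarrow> 'c::euclidean_space) \<Rightarrow>
   ('a \<times> 'b \<Rightarrow> 'c set) \<Rightarrow> 'a set \<Rightarrow> 'a \<Rightarrow> 'b \<Rightarrow> 'b \<Rightarrow> 'a set" where
  "upper_inner G M W wbar xbar r =
     {t. \<exists>y. (t, - r) \<in>
        outer_limit
          ({((w, x), u). u = - G (w, x) \<and> ((w, x), u) \<in> gph (mrestrict M (W \<times> UNIV))} \<times> UNIV)
          (((wbar, xbar), - G (wbar, xbar)), y)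
          (\<lambda>(((w, x), u), y'). proj_set (tangent_cone W w \<times> UNIV) (normal_map G M W w x y'))}"

definition basic_cq ::
  "('a::euclidean_space \<times> 'b::euclidean_space \<Rightarrow> 'c::euclidean_space) \<Rightarrow>
   ('a \<times> 'b \<Rightarrow> 'c set) \<Rightarrow> 'a set \<Rightarrow> 'a \<Rightarrow> 'b \<Rightarrow> bool" where
  "basic_cq G M W wbar xbar \<longleftrightarrow>
     (\<forall>y. (0, 0) \<in> normal_map G M W wbar xbar y \<longrightarrow> y = 0)"

definition strong_cq ::
  "('a::euclidean_space \<times> 'b::euclidean_space \<Rightarrow> 'c::euclidean_space) \<Rightarrow>
   ('a \<times> 'b \<Rightarrow> 'c set) \<Rightarrow> 'a set \<Rightarrow> 'a \<Rightarrow> 'b \<Rightarrow> bool" where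
  "strong_cq G M W wbar xbar \<longleftrightarrow>
     (\<forall>y. (0, 0) \<in>
        outer_limit (gph (mrestrict (sol_map G M) W) \<times> UNIV) ((wbar, xbar), y)
          (\<lambda>((w, x), y'). proj_set (tangent_cone W w \<times> UNIV) (normal_map G M W w x y'))
        \<longrightarrow> y = 0)"

end

theory Submission
  imports Defs
begin

text \<open>
  With \<open>F (w, x) = ((w, x), - G (w, x))\<close> (the map \<open>embed G\<close>) the graph of \<open>S\<close> restricted to \<open>W\<close> is
  the preimage under \<open>F\<close> of the closed graph \<open>C\<close> of \<open>M\<close> restricted to \<open>W \<times> UNIV\<close>, and the union of
  \<open>normal_map G M W w x y\<close> over \<open>y\<close> is the image of \<open>normal_cone C (F (w, x))\<close> under the adjoint
  derivative of \<open>F\<close>. So (1) is the chain rule for normal cones to preimages, applied along a sequence;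
  the constraint qualification persists near the reference point. The chain rule holds in a fuzzy form
  without any qualification, by penalizing \<open>F z \<in> C\<close>; the qualification keeps the multipliers bounded.
  For (2), an unbounded sequence of multipliers \<open>y\<close> would, after normalization, contradict the
  strong qualification, since normal cones and projections onto tangent cones are positively
  homogeneous. For (3), near \<open>wbar\<close> the tangent spaces of \<open>W\<close> are the kernels of a continuous family
  \<open>\<Phi>' w\<close>, and \<open>C\<close> has the normals in the range of the adjoint of \<open>\<Phi>' w\<close> as additional directions.
  Hence a vector in \<open>normal_map\<close> may be replaced by its projection, and the limit can be taken there.
  The reverse inclusion is the chain rule for regular normals.
\<close>

section \<open>Tangent and normal cones\<close>

text \<open>Dropping an initial segment changes no limit, so membership in C is only asked for
  eventually.\<close>

lemma tangent_coneI:
  assumes "x \<in> C" "\<And>k::nat. 0 < t k" "eventually (\<lambda>k. x + t k *\<^sub>R w' k \<in> C) sequentially"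
    "t \<longlonglongrightarrow> 0" "w' \<longlonglongrightarrow> w"
  shows "w \<in> tangent_cone C x"
proof -
  obtain N where "\<forall>k\<ge>N. x + t k *\<^sub>R w' k \<in> C"
    using assms(3) by (auto simp: eventually_sequentially)
  then show ?thesis
    unfolding tangent_cone_def mem_Collect_eq using assms
    by (intro conjI exI[of _ "\<lambda>k. t (k + N)"] exI[of _ "\<lambda>k. w' (k + N)"])
       (auto intro: LIMSEQ_ignore_initial_segment)
qed

lemma tangent_coneE:
  assumes "w \<in> tangent_cone C x"
  obtains t w' where "x \<in> C" "\<And>k::nat. 0 < t k" "\<And>k. x + t k *\<^sub>R w' k \<in> C" "t \<longlonglongrightarrow> 0" "w' \<longlonglongrightarrow> w"
  using assms unfolding tangent_cone_def by blast

lemma zero_in_tangent_cone: "x \<in> C \<Longrightarrow> 0 \<in> tangent_cone C x"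
  by (rule tangent_coneI[where t = "\<lambda>k. inverse (real (Suc k))" and w' = "\<lambda>_. 0"])
     (auto simp del: of_nat_Suc intro: LIMSEQ_inverse_real_of_nat)

lemma tangent_cone_scaleR:
  assumes "w \<in> tangent_cone C x" "0 < c"
  shows "c *\<^sub>R w \<in> tangent_cone C x"
proof -
  obtain t w' where *: "x \<in> C" "\<And>k::nat. 0 < t k" "\<And>k. x + t k *\<^sub>R w' k \<in> C"
    "t \<longlonglongrightarrow> 0" "w' \<longlonglongrightarrow> w"
    using assms(1) by (elim tangent_coneE) metis
  have "(\<lambda>k. t k / c) \<longlonglongrightarrow> 0"
    using tendsto_divide[OF *(4) tendsto_const[of c]] assms by simp
  then show ?thesis
    using * assms by (intro tangent_coneI[where t = "\<lambda>k. t k / c" and w' = "\<lambda>k. c *\<^sub>R w' k"])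
       (auto simp: tendsto_scaleR)
qed

lemma tangent_cone_direction:
  assumes "x \<in> C" "eventually (\<lambda>s::real. x + s *\<^sub>R h \<in> C) (at_right 0)"
  shows "h \<in> tangent_cone C x"
proof (rule tangent_coneI[where t = "\<lambda>k. inverse (real (Suc k))" and w' = "\<lambda>_. h"])
  have "filterlim (\<lambda>k. inverse (real (Suc k))) (at_right 0) sequentially"
    by (intro tendsto_imp_filterlim_at_right LIMSEQ_inverse_real_of_nat) auto
  then show "eventually (\<lambda>k. x + inverse (real (Suc k)) *\<^sub>R h \<in> C) sequentially"
    using assms(2) by (rule eventually_compose_filterlim[rotated])
qed (auto simp del: of_nat_Suc intro: LIMSEQ_inverse_real_of_nat assms)

text \<open>Frechet differentiability makes the remainder uniform over bounded directions, so the
  direction may vary with k.\<close>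

lemma has_derivative_difference_quotient:
  fixes t :: "nat \<Rightarrow> real"
  assumes F: "(F has_derivative F') (at z)"
    and t: "\<And>k. 0 < t k" "t \<longlonglongrightarrow> 0" and w: "w' \<longlonglongrightarrow> w"
  shows "(\<lambda>k. (F (z + t k *\<^sub>R w' k) - F z) /\<^sub>R t k) \<longlonglongrightarrow> F' w"
proof -
  define e where "e y = (1 / norm (y - z)) *\<^sub>R (F y - (F z + F' (y - z)))" for y
  have bl: "bounded_linear F'" and "(e \<longlongrightarrow> 0) (at z)"
    using F unfolding has_derivative_within e_def by auto
  interpret bounded_linear F' by fact
  have e0: "e z = 0" by (simp add: e_def)
  have "isCont e z" using \<open>(e \<longlongrightarrow> 0) (at z)\<close> e0 by (simp add: isCont_def)
  have "(\<lambda>k. z + t k *\<^sub>R w' k) \<longlonglongrightarrow> z"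
    using tendsto_add[OF tendsto_const tendsto_scaleR[OF t(2) w], of z] by simp
  from isCont_tendsto_compose[OF \<open>isCont e z\<close> this]
  have "(\<lambda>k. e (z + t k *\<^sub>R w' k)) \<longlonglongrightarrow> 0" by (simp only: e0)
  then have "(\<lambda>k. F' (w' k) + norm (w' k) *\<^sub>R e (z + t k *\<^sub>R w' k)) \<longlonglongrightarrow> F' w + norm w *\<^sub>R 0"
    by (intro tendsto_intros tendsto w)
  moreover have "F' (w' k) + norm (w' k) *\<^sub>R e (z + t k *\<^sub>R w' k) = (F (z + t k *\<^sub>R w' k) - F z) /\<^sub>R t k" for k
  proof (cases "w' k = 0")
    case False
    then have "norm (w' k) *\<^sub>R e (z + t k *\<^sub>R w' k) = (1 / t k) *\<^sub>R (F (z + t k *\<^sub>R w' k) - (F z + t k *\<^sub>R F' (w' k)))"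
      using t(1)[of k] by (simp add: e_def scaleR)
    also have "\<dots> = (F (z + t k *\<^sub>R w' k) - F z) /\<^sub>R t k - F' (w' k)"
      using t(1)[of k] by (simp add: scaleR_diff_right scaleR_add_right divide_inverse)
    finally show ?thesis by simp
  qed (simp add: zero)
  ultimately show ?thesis by simp
qed

text \<open>The difference quotients of F along a tangent sequence of E are directions leading from
  \<open>F z\<close> into C, and they converge to \<open>F' w\<close>. The open set U makes the
  inclusion a local requirement.\<close>

lemma tangent_cone_image:
  assumes F: "(F has_derivative F') (at z)"
    and U: "open U" "z \<in> U" "F ` (E \<inter> U) \<subseteq> C"
    and w: "w \<in> tangent_cone E z"
  shows "F' w \<in> tangent_cone C (F z)"
proof -
  obtain t w' where *: "z \<in> E" "\<And>k::nat. 0 < t k" "\<And>k. z + t k *\<^sub>R w' k \<in> E"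
    "t \<longlonglongrightarrow> 0" "w' \<longlonglongrightarrow> w"
    using w by (elim tangent_coneE) metis
  have "(\<lambda>k. z + t k *\<^sub>R w' k) \<longlonglongrightarrow> z"
    using tendsto_add[OF tendsto_const tendsto_scaleR[OF *(4,5)], of z] by simp
  then have "eventually (\<lambda>k. z + t k *\<^sub>R w' k \<in> U) sequentially"
    using U(1,2) by (rule topological_tendstoD)
  then have "eventually (\<lambda>k. F z + t k *\<^sub>R ((F (z + t k *\<^sub>R w' k) - F z) /\<^sub>R t k) \<in> C) sequentially"
  proof eventually_elim
    case (elim k)
    then have "F (z + t k *\<^sub>R w' k) \<in> C" using *(3) U(3) by blast
    then show ?case using *(2)[of k] by simp
  qed
  then show ?thesis
    using * U by (intro tangent_coneI[OF _ _ _ _ has_derivative_difference_quotient[OF F *(2,4,5)]]) auto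
qed

lemma tangent_cone_fst_fst:
  assumes "C \<subseteq> (W \<times> UNIV) \<times> UNIV" "h \<in> tangent_cone C ((w, x), u)"
  shows "fst (fst h) \<in> tangent_cone W w"
proof -
  have "((\<lambda>p. fst (fst p)) has_derivative (\<lambda>p. fst (fst p))) (at ((w, x), u))"
    by (intro bounded_linear_imp_has_derivative bounded_linear_compose[OF bounded_linear_fst bounded_linear_fst])
  from tangent_cone_image[OF this open_UNIV UNIV_I _ assms(2), of W] assms(1) show ?thesis by fastforce
qed

section \<open>Regular and limiting normals\<close>

lemma regular_normal_cone_scaleR:
  "v \<in> regular_normal_cone C x \<Longrightarrow> 0 \<le> c \<Longrightarrow> c *\<^sub>R v \<in> regular_normal_cone C x"
  by (auto simp: regular_normal_cone_def mult_nonneg_nonpos)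

lemma normal_coneI:
  assumes "x \<in> C" "\<And>k. v k \<in> regular_normal_cone C (z k)" "z \<longlonglongrightarrow> x" "v \<longlonglongrightarrow> u"
  shows "u \<in> normal_cone C x"
  using assms unfolding normal_cone_def outer_limit_def regular_normal_cone_def by blast

lemma normal_coneE:
  assumes "u \<in> normal_cone C x"
  obtains z v where "x \<in> C" "\<And>k::nat. z k \<in> C" "\<And>k. v k \<in> regular_normal_cone C (z k)"
    "z \<longlonglongrightarrow> x" "v \<longlonglongrightarrow> u"
  using assms unfolding normal_cone_def outer_limit_def by blast

lemma regular_normal_cone_subset: "regular_normal_cone C x \<subseteq> normal_cone C x"
proof
  fix v assume v: "v \<in> regular_normal_cone C x"
  show "v \<in> normal_cone C x"
    by (rule normal_coneI[where v = "\<lambda>_. v" and z = "\<lambda>_. x"])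
       (use v in \<open>auto simp: regular_normal_cone_def\<close>)
qed

lemma normal_cone_scaleR:
  assumes "v \<in> normal_cone C x" "0 \<le> c"
  shows "c *\<^sub>R v \<in> normal_cone C x"
proof -
  obtain z u where *: "x \<in> C" "\<And>k::nat. z k \<in> C" "\<And>k. u k \<in> regular_normal_cone C (z k)"
    "z \<longlonglongrightarrow> x" "u \<longlonglongrightarrow> v"
    using assms(1) by (elim normal_coneE) metis
  show ?thesis
    by (rule normal_coneI[where v = "\<lambda>k. c *\<^sub>R u k" and z = z])
       (simp_all add: * assms regular_normal_cone_scaleR tendsto_scaleR)
qed

lemma null_sequence_inverse_Suc:
  fixes f :: "nat \<Rightarrow> 'a::real_normed_vector"
  assumes "\<And>k. norm (f k) \<le> inverse (real (Suc k))"
  shows "f \<longlonglongrightarrow> 0"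
  using always_eventually[OF allI[OF assms]] LIMSEQ_inverse_real_of_nat by (rule Lim_null_comparison)

lemma tendsto_dist_inverse_Suc:
  fixes x :: "nat \<Rightarrow> 'a::real_normed_vector"
  assumes "x \<longlonglongrightarrow> l" "\<And>k. dist (y k) (x k) < inverse (real (Suc k))"
  shows "y \<longlonglongrightarrow> l"
proof -
  have "(\<lambda>k. y k - x k) \<longlonglongrightarrow> 0"
    using less_imp_le[OF assms(2)] by (intro null_sequence_inverse_Suc) (simp only: dist_norm)
  from tendsto_add[OF this assms(1)] show ?thesis by simp
qed

text \<open>Diagonal argument: each limiting normal is replaced by a regular normal close to it at a
  nearby point. C need not be closed, hence the separate assumption that x lies in C.\<close>

lemma normal_cone_closed_graph:
  assumes "\<And>k. v k \<in> normal_cone C (z k)" "z \<longlonglongrightarrow> x" "v \<longlonglongrightarrow> u" "x \<in> C"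
  shows "u \<in> normal_cone C x"
proof -
  have "\<exists>z' v'. v' \<in> regular_normal_cone C z' \<and> dist z' (z k) < inverse (real (Suc k))
      \<and> dist v' (v k) < inverse (real (Suc k))" for k
  proof -
    obtain y w where "\<And>j::nat. w j \<in> regular_normal_cone C (y j)" "y \<longlonglongrightarrow> z k" "w \<longlonglongrightarrow> v k"
      using assms(1)[of k] by (elim normal_coneE) metis
    moreover have "0 < inverse (real (Suc k))" by simp
    ultimately have "eventually (\<lambda>j. dist (y j) (z k) < inverse (real (Suc k))) sequentially"
      "eventually (\<lambda>j. dist (w j) (v k) < inverse (real (Suc k))) sequentially"
      using tendstoD by blast+
    then have "eventually (\<lambda>j. dist (y j) (z k) < inverse (real (Suc k)) \<and>
      dist (w j) (v k) < inverse (real (Suc k))) sequentially"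
      by eventually_elim auto
    then show ?thesis
      using \<open>\<And>j. w j \<in> _\<close> eventually_happens' sequentially_bot by blast
  qed
  then obtain z' v' where "\<And>k. v' k \<in> regular_normal_cone C (z' k)"
    "\<And>k. dist (z' k) (z k) < inverse (real (Suc k))" "\<And>k. dist (v' k) (v k) < inverse (real (Suc k))"
    by metis
  then show ?thesis
    using assms by (intro normal_coneI[where v = v' and z = z'])
      (auto intro: tendsto_dist_inverse_Suc)
qed

text \<open>Polarity to the contingent cone implies the Frechet inequality. Otherwise the normalized
  differences of violating points would accumulate, by compactness of the sphere, at a tangent
  direction whose inner product with v is at least e.\<close>

lemma regular_normal_cone_eps:
  assumes v: "v \<in> regular_normal_cone C x" and "0 < e"
  obtains d where "0 < d" "\<And>z. z \<in> C \<Longrightarrow> dist z x \<le> d \<Longrightarrow> v \<bullet> (z - x) \<le> e * norm (z - x)"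
proof (rule ccontr)
  assume "\<not> thesis"
  then have "\<exists>z. z \<in> C \<and> dist z x \<le> inverse (real (Suc k)) \<and> v \<bullet> (z - x) > e * norm (z - x)" for k
    using that[of "inverse (real (Suc k))"] by (metis inverse_positive_iff_positive linorder_not_le of_nat_0_less_iff zero_less_Suc)
  then obtain z where z: "\<And>k. z k \<in> C" "\<And>k. dist (z k) x \<le> inverse (real (Suc k))"
    "\<And>k. v \<bullet> (z k - x) > e * norm (z k - x)"
    by metis
  define t w where "t k = norm (z k - x)" and "w k = (z k - x) /\<^sub>R norm (z k - x)" for k
  have t: "0 < t k" for k using z(3)[of k] by (auto simp: t_def)
  have w: "v \<bullet> w k > e" for k
  proof -
    have "e < (v \<bullet> (z k - x)) / norm (z k - x)"
      using z(3)[of k] t[of k] by (simp add: t_def pos_less_divide_eq)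
    then show ?thesis by (simp add: w_def divide_inverse mult.commute)
  qed
  have "w k \<in> sphere 0 1" for k using t[of k] by (simp add: w_def t_def)
  then obtain l r where r: "strict_mono r" "(w \<circ> r) \<longlonglongrightarrow> l"
    using compact_sphere[of "0::'a" 1] unfolding compact_def by metis
  have "t \<longlonglongrightarrow> 0"
    using z(2) by (intro null_sequence_inverse_Suc) (simp only: t_def dist_norm real_norm_def abs_norm_cancel)
  then have "(t \<circ> r) \<longlonglongrightarrow> 0" using r(1) LIMSEQ_subseq_LIMSEQ by blast
  moreover have "x + t k *\<^sub>R w k = z k" for k using t[of k] by (simp add: t_def w_def)
  moreover have "x \<in> C" using v by (simp add: regular_normal_cone_def)
  ultimately have "l \<in> tangent_cone C x"
    using r(2) t z(1) by (intro tangent_coneI[where t = "t \<circ> r" and w' = "w \<circ> r"]) auto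
  then have "v \<bullet> l \<le> 0" using v by (simp add: regular_normal_cone_def)
  have "(\<lambda>k. v \<bullet> (w \<circ> r) k) \<longlonglongrightarrow> v \<bullet> l" by (intro tendsto_intros r)
  moreover have "e \<le> v \<bullet> (w \<circ> r) k" for k using w[of "r k"] by simp
  ultimately have "e \<le> v \<bullet> l" by (meson LIMSEQ_le_const)
  with \<open>v \<bullet> l \<le> 0\<close> show False using \<open>0 < e\<close> by simp
qed

text \<open>Squaring the nearest-point inequality along a tangent sequence and dividing by the step
  length leaves a bound that vanishes with the step.\<close>

lemma proximal_normal:
  assumes c: "c \<in> C" and "0 < d"
    and le: "\<And>c'. c' \<in> C \<Longrightarrow> dist c' c < d \<Longrightarrow> norm (p - c) \<le> norm (p - c')"
  shows "p - c \<in> regular_normal_cone C c"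
  unfolding regular_normal_cone_def
proof (intro CollectI conjI ballI c)
  fix w assume "w \<in> tangent_cone C c"
  then obtain t w' where *: "\<And>k::nat. 0 < t k" "\<And>k. c + t k *\<^sub>R w' k \<in> C"
    "t \<longlonglongrightarrow> 0" "w' \<longlonglongrightarrow> w"
    by (elim tangent_coneE) metis
  have "(\<lambda>k. c + t k *\<^sub>R w' k) \<longlonglongrightarrow> c"
    using tendsto_add[OF tendsto_const tendsto_scaleR[OF *(3,4)], of c] by simp
  then have "eventually (\<lambda>k. dist (c + t k *\<^sub>R w' k) c < d) sequentially"
    using \<open>0 < d\<close> by (rule tendstoD)
  then have "eventually (\<lambda>k. (p - c) \<bullet> w' k \<le> t k * (norm (w' k))\<^sup>2 / 2) sequentially"
  proof eventually_elim
    case (elim k)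
    have "norm (p - c) ^ 2 \<le> norm ((p - c) - t k *\<^sub>R w' k) ^ 2"
      using le[OF *(2)[of k] elim] by (intro power_mono) (auto simp: algebra_simps)
    then have "t k * (2 * ((p - c) \<bullet> w' k)) \<le> t k * (t k * (norm (w' k))\<^sup>2)"
      unfolding power2_norm_eq_inner by (simp add: inner_diff inner_commute algebra_simps power2_eq_square)
    then show ?case using *(1)[of k] by (auto dest: mult_left_le_imp_le)
  qed
  moreover have "(\<lambda>k. t k * (norm (w' k))\<^sup>2 / 2) \<longlonglongrightarrow> 0 * (norm w)\<^sup>2 / 2"
    by (intro tendsto_intros *) simp
  moreover have "(\<lambda>k. (p - c) \<bullet> w' k) \<longlonglongrightarrow> (p - c) \<bullet> w" by (intro tendsto_intros *)
  ultimately show "(p - c) \<bullet> w \<le> 0"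
    using tendsto_le[OF sequentially_bot] by fastforce
qed

section \<open>The chain rule for normal cones to preimages\<close>

text \<open>As a finite sum over the basis, the adjoint inherits convergence from the pointwise
  convergence of the maps.\<close>

lemma adjoint_eq_sum_Basis:
  fixes f :: "'a::euclidean_space \<Rightarrow> 'b::euclidean_space"
  assumes "linear f"
  shows "adjoint f y = (\<Sum>b\<in>Basis. (f b \<bullet> y) *\<^sub>R b)"
  using euclidean_representation[of "adjoint f y"]
  by (simp add: adjoint_clauses[OF assms] inner_commute)

lemma adjoint_scaleR:
  fixes f :: "'a::euclidean_space \<Rightarrow> 'b::euclidean_space"
  assumes "linear f"
  shows "adjoint f (c *\<^sub>R y) = c *\<^sub>R adjoint f y"
  using adjoint_linear[OF assms] by (simp add: linear_cmul)

lemma tendsto_adjoint: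
  fixes f :: "'i \<Rightarrow> 'a::euclidean_space \<Rightarrow> 'b::euclidean_space"
  assumes "\<And>k. linear (f k)" "linear f0" "\<And>h. ((\<lambda>k. f k h) \<longlongrightarrow> f0 h) A" "(n \<longlongrightarrow> n0) A"
  shows "((\<lambda>k. adjoint (f k) (n k)) \<longlongrightarrow> adjoint f0 n0) A"
  unfolding adjoint_eq_sum_Basis[OF assms(1)] adjoint_eq_sum_Basis[OF assms(2)]
  by (intro tendsto_sum tendsto_scaleR tendsto_inner assms tendsto_const)

lemma tendsto_adjoint_derivative:
  fixes F' :: "'a::euclidean_space \<Rightarrow> 'b::euclidean_space \<Rightarrow> 'c::euclidean_space"
  assumes lin: "\<And>z. linear (F' z)" and cont: "\<And>h. continuous_on UNIV (\<lambda>z. F' z h)"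
    and z: "(z \<longlongrightarrow> z0) A" and n: "(n \<longlongrightarrow> n0) A"
  shows "((\<lambda>k. adjoint (F' (z k)) (n k)) \<longlongrightarrow> adjoint (F' z0) n0) A"
proof (rule tendsto_adjoint[OF lin lin _ n])
  show "((\<lambda>k. F' (z k) h) \<longlongrightarrow> F' z0 h) A" for h
    using cont[of h] z by (intro isCont_tendsto_compose[where g = "\<lambda>z. F' z h"])
      (simp_all add: continuous_on_eq_continuous_at)
qed

section \<open>The fuzzy chain rule by penalization\<close>

text \<open>
  The minimizers of \<open>- v \<bullet> (z - z0) + e * norm (z - z0) + j * (norm (F z - c))\<^sup>2\<close> over \<open>z\<close> near \<open>z0\<close>
  and \<open>c \<in> C\<close> converge to \<open>(z0, F z0)\<close> as the penalty parameter \<open>j\<close> grows.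
\<close>

lemma penalty_minimizers:
  fixes F :: "'a::euclidean_space \<Rightarrow> 'b::euclidean_space"
  assumes cont: "continuous_on UNIV F" and C: "closed C"
    and v: "v \<in> regular_normal_cone (F -` C) z0" and e: "0 < e"
  obtains z c j where "0 < j" "dist z z0 < e" "dist c (F z0) < e" "c \<in> C"
    "eventually (\<lambda>z'. - (v \<bullet> (z - z0)) + e * norm (z - z0) + j * (norm (F z - c))\<^sup>2
        \<le> - (v \<bullet> (z' - z0)) + e * norm (z' - z0) + j * (norm (F z' - c))\<^sup>2) (nhds z)"
    "eventually (\<lambda>c'. c' \<in> C \<longrightarrow> norm (F z - c) \<le> norm (F z - c')) (nhds c)"
proof -
  \<comment> \<open>The slope \<open>e / 2\<close> is half the weight of the norm term in the
    objective; the other half will force the limit of the minimizers to be z0.\<close>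
  obtain d where d: "0 < d" "\<And>z. z \<in> F -` C \<Longrightarrow> dist z z0 \<le> d \<Longrightarrow> v \<bullet> (z - z0) \<le> e / 2 * norm (z - z0)"
    using regular_normal_cone_eps[OF v, of "e / 2"] e by (metis half_gt_zero)
  have z0: "F z0 \<in> C" using v by (simp add: regular_normal_cone_def)
  define \<psi> where "\<psi> z = - (v \<bullet> (z - z0)) + e * norm (z - z0)" for z
  define \<phi> where "\<phi> j p = \<psi> (fst p) + j * (norm (F (fst p) - snd p))\<^sup>2" for j :: real and p
  define K where "K = cball z0 d \<times> (C \<inter> cball (F z0) 1)"
  have K: "compact K" unfolding K_def
    by (intro compact_Times compact_cball closed_Int_compact C)
  have z0K: "(z0, F z0) \<in> K" using d z0 by (simp add: K_def)
  have cont\<psi>: "continuous_on UNIV \<psi>" unfolding \<psi>_def by (intro continuous_intros)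
  have contF: "continuous_on A (\<lambda>x. F (g x))" if "continuous_on A g" for A and g :: "'a \<times> 'b \<Rightarrow> 'a"
    using continuous_on_compose2[OF cont that] by blast
  have cont\<psi>': "continuous_on A (\<lambda>x. \<psi> (g x))" if "continuous_on A g" for A and g :: "'a \<times> 'b \<Rightarrow> 'a"
    using continuous_on_compose2[OF cont\<psi> that] by blast
  have "\<exists>p\<in>K. \<forall>q\<in>K. \<phi> (real k) p \<le> \<phi> (real k) q" for k
    using z0K unfolding \<phi>_def
    by (intro continuous_attains_inf K) (auto intro!: continuous_intros contF cont\<psi>')
  then obtain p where p: "\<And>k. p k \<in> K" "\<And>k q. q \<in> K \<Longrightarrow> \<phi> (real k) (p k) \<le> \<phi> (real k) q"
    by metis
  obtain q r where r: "q \<in> K" "strict_mono r" "(p \<circ> r) \<longlonglongrightarrow> q"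
    using K p(1) unfolding compact_def by metis
  have q1: "(\<lambda>k. fst (p (r k))) \<longlonglongrightarrow> fst q" and q2: "(\<lambda>k. snd (p (r k))) \<longlonglongrightarrow> snd q"
    using tendsto_fst[OF r(3)] tendsto_snd[OF r(3)] by (simp_all add: o_def)
  have Fq: "(\<lambda>k. F (fst (p (r k)))) \<longlonglongrightarrow> F (fst q)"
    using cont q1 by (intro isCont_tendsto_compose[where g = F]) (auto simp: continuous_on_eq_continuous_at)
  \<comment> \<open>The competitor \<open>(z0, F z0)\<close> has objective value 0.\<close>
  have le0: "\<phi> (real k) (p k) \<le> 0" for k
    using p(2)[OF z0K, of k] by (simp add: \<phi>_def \<psi>_def)
  have rpos: "eventually (\<lambda>k. 0 < r k) sequentially"
    using filterlim_subseq[OF r(2)] eventually_gt_at_top[of 0] eventually_compose_filterlim by blast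
  \<comment> \<open>\<open>\<psi>\<close> is bounded below on K by a constant, so the penalized
    squared distance is of order 1 / k and the limit point is feasible.\<close>
  have "(norm (F (fst q) - snd q))\<^sup>2 \<le> 0"
  proof (rule tendsto_le[OF sequentially_bot])
    have "\<psi> (fst (p k)) \<ge> - (norm v * d)" for k
    proof -
      have "norm (fst (p k) - z0) \<le> d"
        using p(1)[of k] by (auto simp: K_def dist_norm norm_minus_commute)
      then have "v \<bullet> (fst (p k) - z0) \<le> norm v * d"
        using norm_cauchy_schwarz[of v "fst (p k) - z0"] mult_left_mono[of _ d "norm v"]
        by (meson norm_ge_zero order_trans)
      moreover have "0 \<le> e * norm (fst (p k) - z0)" using e by simp
      ultimately show ?thesis by (simp add: \<psi>_def)
    qed
    then have "real k * (norm (F (fst (p k)) - snd (p k)))\<^sup>2 \<le> norm v * d" for k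
      using le0[of k] by (simp add: \<phi>_def) (smt (verit))
    then have *: "(norm (F (fst (p k)) - snd (p k)))\<^sup>2 \<le> norm v * d / real k" if "0 < k" for k
      using that by (simp add: pos_le_divide_eq mult.commute)
    show "eventually (\<lambda>k. (norm (F (fst (p (r k))) - snd (p (r k))))\<^sup>2 \<le> norm v * d / real (r k)) sequentially"
      using rpos by eventually_elim (rule *)
    have "(\<lambda>k. norm v * d / real k) \<longlonglongrightarrow> 0" by (rule lim_const_over_n)
    then show "(\<lambda>k. norm v * d / real (r k)) \<longlonglongrightarrow> 0"
      using LIMSEQ_subseq_LIMSEQ[OF _ r(2)] by (fastforce simp: o_def)
    show "(\<lambda>k. (norm (F (fst (p (r k))) - snd (p (r k))))\<^sup>2) \<longlonglongrightarrow> (norm (F (fst q) - snd q))\<^sup>2"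
      by (intro tendsto_intros Fq q2)
  qed
  then have q: "snd q = F (fst q)" by simp
  have "(\<lambda>k. \<psi> (fst (p (r k)))) \<longlonglongrightarrow> \<psi> (fst q)"
    using cont\<psi> q1 by (intro isCont_tendsto_compose[where g = \<psi>]) (auto simp: continuous_on_eq_continuous_at)
  moreover have "\<psi> (fst (p k)) \<le> 0" for k
  proof -
    have "0 \<le> real k * (norm (F (fst (p k)) - snd (p k)))\<^sup>2" by simp
    then show ?thesis using le0[of k] unfolding \<phi>_def by linarith
  qed
  ultimately have "\<psi> (fst q) \<le> 0"
    using LIMSEQ_le_const2 by blast
  moreover have "v \<bullet> (fst q - z0) \<le> e / 2 * norm (fst q - z0)"
    using r(1) q by (intro d(2)) (auto simp: K_def dist_commute)
  ultimately have "e / 2 * norm (fst q - z0) \<le> 0" unfolding \<psi>_def by linarith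
  then have fq: "fst q = z0" using e by (simp add: mult_le_0_iff)
  \<comment> \<open>The strict bounds by d and 1 put the minimizer inside the two balls defining K,
    so that minimality on K becomes local minimality in each variable separately.\<close>
  have "eventually (\<lambda>k. dist (fst (p (r k))) z0 < min e d) sequentially"
    "eventually (\<lambda>k. dist (snd (p (r k))) (F z0) < min e 1) sequentially"
    "eventually (\<lambda>k. 0 < r k) sequentially"
    using tendstoD[OF q1, of "min e d"] tendstoD[OF q2, of "min e 1"] e d(1) q fq rpos by auto
  then have "eventually (\<lambda>k. dist (fst (p (r k))) z0 < min e d \<and> dist (snd (p (r k))) (F z0) < min e 1 \<and> 0 < r k) sequentially"
    by eventually_elim simp
  from eventually_happens'[OF sequentially_bot this]
  obtain k where k: "dist (fst (p k)) z0 < min e d" "dist (snd (p k)) (F z0) < min e 1" "0 < k"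
    by blast
  define z c where "z = fst (p k)" and "c = snd (p k)"
  have zc: "dist z z0 < d" "dist c (F z0) < 1" "c \<in> C" "(z, c) \<in> K"
    using k p(1)[of k] by (auto simp: z_def c_def K_def)
  show thesis
  proof
    show "0 < real k" "dist z z0 < e" "dist c (F z0) < e" "c \<in> C"
      using k zc by (simp_all add: z_def c_def)
    have "eventually (\<lambda>z'. z' \<in> ball z0 d) (nhds z)"
      using zc(1) by (intro eventually_nhds_in_open) (auto simp: dist_commute)
    then show "eventually (\<lambda>z'. - (v \<bullet> (z - z0)) + e * norm (z - z0) + real k * (norm (F z - c))\<^sup>2
        \<le> - (v \<bullet> (z' - z0)) + e * norm (z' - z0) + real k * (norm (F z' - c))\<^sup>2) (nhds z)"
    proof eventually_elim
      case (elim z')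
      then have "(z', c) \<in> K" using zc by (auto simp: K_def)
      from p(2)[OF this, of k] show ?case by (simp add: \<phi>_def \<psi>_def z_def c_def)
    qed
    have "eventually (\<lambda>c'. c' \<in> ball (F z0) 1) (nhds c)"
      using zc(2) by (intro eventually_nhds_in_open) (auto simp: dist_commute)
    then show "eventually (\<lambda>c'. c' \<in> C \<longrightarrow> norm (F z - c) \<le> norm (F z - c')) (nhds c)"
    proof (eventually_elim, intro impI)
      fix c' assume "c' \<in> ball (F z0) 1" "c' \<in> C"
      then have "(z, c') \<in> K" using zc by (auto simp: K_def)
      from p(2)[OF this, of k] have "real k * (norm (F z - c))\<^sup>2 \<le> real k * (norm (F z - c'))\<^sup>2"
        by (simp add: \<phi>_def z_def c_def)
      then have "(norm (F z - c))\<^sup>2 \<le> (norm (F z - c'))\<^sup>2" using k(3) by simp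
      then show "norm (F z - c) \<le> norm (F z - c')" by (rule power2_le_imp_le) simp
    qed
  qed
qed

text \<open>At a penalty minimizer, optimality in c makes \<open>F z - c\<close> a proximal normal
  to C, and optimality in z makes its multiple n a multiplier for v up to e. There is no bound on n
  as e shrinks.\<close>

lemma fuzzy_chain_rule:
  fixes F :: "'a::euclidean_space \<Rightarrow> 'b::euclidean_space"
  assumes F: "\<And>z. (F has_derivative F' z) (at z)" and C: "closed C"
    and v: "v \<in> regular_normal_cone (F -` C) z0" and e: "0 < e"
  obtains z c n where "dist z z0 < e" "dist c (F z0) < e" "n \<in> regular_normal_cone C c"
    "dist (adjoint (F' z) n) v \<le> e"
proof -
  have "continuous_on UNIV F"
    by (intro continuous_at_imp_continuous_on ballI has_derivative_continuous[OF F])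
  then obtain z c j where j: "0 < j" "dist z z0 < e" "dist c (F z0) < e" "c \<in> C" and
    optz: "eventually (\<lambda>z'. - (v \<bullet> (z - z0)) + e * norm (z - z0) + j * (norm (F z - c))\<^sup>2
        \<le> - (v \<bullet> (z' - z0)) + e * norm (z' - z0) + j * (norm (F z' - c))\<^sup>2) (nhds z)" and
    optc: "eventually (\<lambda>c'. c' \<in> C \<longrightarrow> norm (F z - c) \<le> norm (F z - c')) (nhds c)"
    by (rule penalty_minimizers[OF _ C v e])
  \<comment> \<open>The gradient of the penalty term with respect to the value
    \<open>F z\<close>.\<close>
  define n where "n = (2 * j) *\<^sub>R (F z - c)"
  have linF: "linear (F' z)" using F has_derivative_linear by blast
  obtain d where "0 < d" "\<And>c'. dist c' c < d \<Longrightarrow> c' \<in> C \<Longrightarrow> norm (F z - c) \<le> norm (F z - c')"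
    using optc unfolding eventually_nhds_metric by auto
  then have "F z - c \<in> regular_normal_cone C c"
    using j(4) by (intro proximal_normal) auto
  then have n: "n \<in> regular_normal_cone C c"
    unfolding n_def using j(1) by (intro regular_normal_cone_scaleR) simp_all
  have opt: "0 \<le> - (v \<bullet> h) + n \<bullet> F' z h + e * norm h" for h
  proof (rule ccontr)
    assume neg: "\<not> ?thesis"
    \<comment> \<open>The objective along the ray, up to a constant, with the term
      \<open>e * norm (z - z0)\<close>, which is not differentiable at z0, replaced by its linear
      upper bound for positive s. Thus \<open>\<theta>\<close> is differentiable at 0 and still has
      a one-sided local minimum there.\<close>
    define \<theta> where "\<theta> s = - (v \<bullet> (z + s *\<^sub>R h - z0)) + j * ((F (z + s *\<^sub>R h) - c) \<bullet> (F (z + s *\<^sub>R h) - c))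
      + e * s * norm h" for s :: real
    have d1: "((\<lambda>s::real. z + s *\<^sub>R h) has_derivative (\<lambda>s. s *\<^sub>R h)) (at 0)"
      by (auto intro!: derivative_eq_intros)
    have "((\<lambda>s::real. F (z + s *\<^sub>R h)) has_derivative (\<lambda>s. F' z (s *\<^sub>R h))) (at 0)"
      using diff_chain_at[OF d1, of F "F' z"] F[of z] by (simp add: o_def)
    then have d2: "((\<lambda>s::real. F (z + s *\<^sub>R h) - c) has_derivative (\<lambda>s. s *\<^sub>R F' z h)) (at 0)"
      using has_derivative_diff[OF _ has_derivative_const[of c]] by (simp add: linear_cmul[OF linF])
    have d3: "((\<lambda>s::real. z + s *\<^sub>R h - z0) has_derivative (\<lambda>s. s *\<^sub>R h)) (at 0)"
      using has_derivative_diff[OF d1 has_derivative_const[of z0]] by simp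
    have d4: "((\<lambda>s::real. e * s * norm h) has_derivative (\<lambda>s. e * s * norm h)) (at 0)"
      by (auto intro!: derivative_eq_intros)
    have "(\<theta> has_derivative (\<lambda>s. - (v \<bullet> (s *\<^sub>R h)) +
        j * ((F (z + 0 *\<^sub>R h) - c) \<bullet> (s *\<^sub>R F' z h) + (s *\<^sub>R F' z h) \<bullet> (F (z + 0 *\<^sub>R h) - c)) + e * s * norm h)) (at 0)"
      unfolding \<theta>_def[abs_def]
      by (intro has_derivative_add has_derivative_minus has_derivative_inner_right[OF d3]
          has_derivative_mult_right has_derivative_inner[OF d2 d2] d4)
    then have "(\<theta> has_derivative (\<lambda>s. s * (- (v \<bullet> h) + n \<bullet> F' z h + e * norm h))) (at 0)"
    proof (rule has_derivative_eq_rhs, intro ext)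
      fix s :: real
      have *: "(s *\<^sub>R F' z h) \<bullet> (F z - c) = s * ((F z - c) \<bullet> F' z h)"
        by (simp only: inner_scaleR_left inner_commute[of "F' z h"])
      show "- (v \<bullet> (s *\<^sub>R h)) + j * ((F (z + 0 *\<^sub>R h) - c) \<bullet> (s *\<^sub>R F' z h) +
          (s *\<^sub>R F' z h) \<bullet> (F (z + 0 *\<^sub>R h) - c)) + e * s * norm h
          = s * (- (v \<bullet> h) + n \<bullet> F' z h + e * norm h)"
        unfolding scaleR_zero_left add_0_right * n_def inner_scaleR_left inner_scaleR_right
        by (simp add: inner_commute[of "F' z h"] right_diff_distrib distrib_left)
    qed
    then have "(\<theta> has_real_derivative (- (v \<bullet> h) + n \<bullet> F' z h + e * norm h)) (at 0)"
      unfolding has_field_derivative_def by (rule has_derivative_eq_rhs) (intro ext mult.commute)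
    from DERIV_neg_dec_right[OF this] neg
    obtain d where d: "0 < d" "\<And>s. 0 < s \<Longrightarrow> s < d \<Longrightarrow> \<theta> s < \<theta> 0" by auto
    have "((\<lambda>s. z + s *\<^sub>R h) \<longlongrightarrow> z) (at_right (0::real))"
      by (auto intro!: tendsto_eq_intros)
    from eventually_compose_filterlim[OF optz this]
    have "eventually (\<lambda>s. \<theta> 0 \<le> \<theta> s) (at_right 0)"
      using eventually_at_right_less[of "0::real"]
    proof eventually_elim
      case (elim s)
      have "norm (z + s *\<^sub>R h - z0) \<le> norm (z - z0) + s * norm h"
        using norm_triangle_ineq[of "z - z0" "s *\<^sub>R h"] elim(2) by (simp add: algebra_simps)
      then have "e * norm (z + s *\<^sub>R h - z0) \<le> e * norm (z - z0) + e * s * norm h"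
        using e mult_left_mono[of _ _ e] by (fastforce simp: algebra_simps)
      then show ?case using elim(1) by (simp add: \<theta>_def power2_norm_eq_inner)
    qed
    moreover have "eventually (\<lambda>s. s < d) (at_right 0)" "eventually (\<lambda>s::real. 0 < s) (at_right 0)"
      using d(1) eventually_at_right_field eventually_at_right_less by blast+
    ultimately have "eventually (\<lambda>s::real. False) (at_right 0)"
      by eventually_elim (use d(2) in fastforce)
    then show False by simp
  qed
  \<comment> \<open>Testing the optimality condition in the direction of the residual itself bounds
    its norm by e.\<close>
  define g where "g = v - adjoint (F' z) n"
  have "norm g * norm g \<le> e * norm g"
    using opt[of g] by (simp add: g_def adjoint_clauses[OF linF, symmetric] inner_diff inner_commute
        flip: power2_norm_eq_inner power2_eq_square)
      (simp add: power2_norm_eq_inner inner_diff inner_commute)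
  then have "dist (adjoint (F' z) n) v \<le> e"
    using e by (cases "g = 0") (auto simp: g_def dist_norm norm_minus_commute)
  with that j n show thesis by blast
qed

section \<open>The exact chain rule under a constraint qualification\<close>

text \<open>Treats bounded and unbounded multipliers together. Scaling by
  \<open>1 / (1 + norm)\<close> stays defined at 0, and the limits satisfy
  \<open>norm m = 1 - l\<close>: either l is 0 and m is a unit vector, or the unscaled subsequence
  converges.\<close>

lemma normalized_subsequence:
  fixes n :: "nat \<Rightarrow> 'a::euclidean_space"
  obtains r l m where "strict_mono (r :: nat \<Rightarrow> nat)"
    "(\<lambda>k. inverse (1 + norm (n (r k)))) \<longlonglongrightarrow> l"
    "(\<lambda>k. inverse (1 + norm (n (r k))) *\<^sub>R n (r k)) \<longlonglongrightarrow> m"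
    "0 \<le> l" "l = 0 \<longrightarrow> m \<noteq> 0" "l \<noteq> 0 \<longrightarrow> (\<lambda>k. n (r k)) \<longlonglongrightarrow> m /\<^sub>R l"
proof -
  define \<mu> where "\<mu> k = inverse (1 + norm (n k))" for k
  have pos: "0 < \<mu> k" for k by (simp add: \<mu>_def add_pos_nonneg)
  have eq: "norm (\<mu> k *\<^sub>R n k) = 1 - \<mu> k" for k
    unfolding \<mu>_def by (simp add: field_simps add_nonneg_eq_0_iff)
  have "\<forall>k. (\<mu> k, \<mu> k *\<^sub>R n k) \<in> {0..1} \<times> cball 0 1"
  proof
    fix k
    have "1 - \<mu> k \<ge> 0" by (metis eq norm_ge_zero)
    then show "(\<mu> k, \<mu> k *\<^sub>R n k) \<in> {0..1} \<times> cball 0 1" using pos[of k] eq[of k] by (simp del: norm_scaleR)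
  qed
  moreover have "compact ({0..1::real} \<times> cball (0::'a) 1)"
    by (intro compact_Times compact_cball compact_Icc)
  ultimately obtain q r where r: "strict_mono r" "((\<lambda>k. (\<mu> k, \<mu> k *\<^sub>R n k)) \<circ> r) \<longlonglongrightarrow> q"
    by (elim seq_compactE[OF compact_imp_seq_compact])
  have l: "(\<lambda>k. \<mu> (r k)) \<longlonglongrightarrow> fst q" and m: "(\<lambda>k. \<mu> (r k) *\<^sub>R n (r k)) \<longlonglongrightarrow> snd q"
    using tendsto_fst[OF r(2)] tendsto_snd[OF r(2)] by (simp_all add: o_def)
  have "(\<lambda>k. 1 - \<mu> (r k)) \<longlonglongrightarrow> norm (snd q)"
    using tendsto_norm[OF m] by (simp only: eq)
  moreover have "(\<lambda>k. 1 - \<mu> (r k)) \<longlonglongrightarrow> 1 - fst q" by (intro tendsto_intros l)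
  ultimately have "norm (snd q) = 1 - fst q" by (rule LIMSEQ_unique)
  moreover have "0 \<le> fst q"
    by (rule LIMSEQ_le_const[OF l]) (auto simp: less_imp_le[OF pos])
  moreover have "(\<lambda>k. n (r k)) \<longlonglongrightarrow> snd q /\<^sub>R fst q" if "fst q \<noteq> 0"
  proof -
    have "(\<lambda>k. (\<mu> (r k) *\<^sub>R n (r k)) /\<^sub>R \<mu> (r k)) \<longlonglongrightarrow> snd q /\<^sub>R fst q"
      using that by (intro tendsto_intros l m)
    moreover have "(\<mu> k *\<^sub>R n k) /\<^sub>R \<mu> k = n k" for k using pos[of k] by simp
    ultimately show ?thesis by simp
  qed
  moreover have "snd q \<noteq> 0" if "fst q = 0" using \<open>norm (snd q) = _\<close> that by auto
  ultimately show thesis using that[OF r(1) l[unfolded \<mu>_def] m[unfolded \<mu>_def]] by auto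
qed

text \<open>The multipliers of the fuzzy rule are followed along a normalized subsequence. Were they
  unbounded, their limit direction would be a nonzero normal annihilated by the adjoint, which the
  qualification excludes.\<close>

lemma normal_cone_chain_rule:
  fixes F :: "'a::euclidean_space \<Rightarrow> 'b::euclidean_space"
  assumes F: "\<And>z. (F has_derivative F' z) (at z)" and cont: "\<And>h. continuous_on UNIV (\<lambda>z. F' z h)"
    and C: "closed C"
    and cq: "\<And>n. n \<in> normal_cone C (F z0) \<Longrightarrow> adjoint (F' z0) n = 0 \<Longrightarrow> n = 0"
    and v: "v \<in> normal_cone (F -` C) z0"
  obtains n where "n \<in> normal_cone C (F z0)" "v = adjoint (F' z0) n"
proof -
  have lin: "linear (F' z)" for z using F has_derivative_linear by blast
  obtain y u where yu: "F z0 \<in> C" "\<And>k::nat. u k \<in> regular_normal_cone (F -` C) (y k)"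
    "y \<longlonglongrightarrow> z0" "u \<longlonglongrightarrow> v"
    using v by (elim normal_coneE) auto
  have "\<exists>z c n. dist z (y k) < inverse (real (Suc k)) \<and> dist c (F (y k)) < inverse (real (Suc k))
      \<and> n \<in> regular_normal_cone C c \<and> dist (adjoint (F' z) n) (u k) < inverse (real (Suc k))" for k
  proof -
    \<comment> \<open>Halving turns the non-strict last estimate of \<open>fuzzy_chain_rule\<close>
      into a strict one.\<close>
    have "0 < inverse (real (Suc k)) / 2" by simp
    from fuzzy_chain_rule[OF F C yu(2)[of k] this] obtain z c n
      where "dist z (y k) < inverse (real (Suc k)) / 2" "dist c (F (y k)) < inverse (real (Suc k)) / 2"
        "n \<in> regular_normal_cone C c" "dist (adjoint (F' z) n) (u k) \<le> inverse (real (Suc k)) / 2"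
      by blast
    moreover have "inverse (real (Suc k)) / 2 < inverse (real (Suc k))" by simp
    ultimately show ?thesis by (meson less_trans le_less_trans)
  qed
  then obtain z c n where zcn: "\<And>k. dist (z k) (y k) < inverse (real (Suc k))"
    "\<And>k. dist (c k) (F (y k)) < inverse (real (Suc k))" "\<And>k. n k \<in> regular_normal_cone C (c k)"
    "\<And>k. dist (adjoint (F' (z k)) (n k)) (u k) < inverse (real (Suc k))"
    by metis
  have z: "z \<longlonglongrightarrow> z0" by (rule tendsto_dist_inverse_Suc[OF yu(3) zcn(1)])
  have "(\<lambda>k. F (y k)) \<longlonglongrightarrow> F z0"
    by (rule isCont_tendsto_compose[OF has_derivative_continuous[OF F] yu(3)])
  then have c: "c \<longlonglongrightarrow> F z0" by (rule tendsto_dist_inverse_Suc[OF _ zcn(2)])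
  have a: "(\<lambda>k. adjoint (F' (z k)) (n k)) \<longlonglongrightarrow> v" by (rule tendsto_dist_inverse_Suc[OF yu(4) zcn(4)])
  obtain r l m where r: "strict_mono (r :: nat \<Rightarrow> nat)" "(\<lambda>k. inverse (1 + norm (n (r k)))) \<longlonglongrightarrow> l"
    "(\<lambda>k. inverse (1 + norm (n (r k))) *\<^sub>R n (r k)) \<longlonglongrightarrow> m"
    "0 \<le> l" "l = 0 \<longrightarrow> m \<noteq> 0" "l \<noteq> 0 \<longrightarrow> (\<lambda>k. n (r k)) \<longlonglongrightarrow> m /\<^sub>R l"
    by (rule normalized_subsequence[of n])
  have zr: "(\<lambda>k. z (r k)) \<longlonglongrightarrow> z0" and cr: "(\<lambda>k. c (r k)) \<longlonglongrightarrow> F z0"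
    and ar: "(\<lambda>k. adjoint (F' (z (r k))) (n (r k))) \<longlonglongrightarrow> v"
    using LIMSEQ_subseq_LIMSEQ[OF z r(1)] LIMSEQ_subseq_LIMSEQ[OF c r(1)] LIMSEQ_subseq_LIMSEQ[OF a r(1)]
    by (simp_all add: o_def)
  have m: "m \<in> normal_cone C (F z0)"
    by (rule normal_coneI[OF yu(1) _ cr r(3)]) (auto intro!: regular_normal_cone_scaleR zcn(3))
  have "(\<lambda>k. adjoint (F' (z (r k))) (inverse (1 + norm (n (r k))) *\<^sub>R n (r k))) \<longlonglongrightarrow> adjoint (F' z0) m"
    by (rule tendsto_adjoint_derivative[OF lin cont zr r(3)])
  moreover have "(\<lambda>k. inverse (1 + norm (n (r k))) *\<^sub>R adjoint (F' (z (r k))) (n (r k))) \<longlonglongrightarrow> l *\<^sub>R v"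
    by (intro tendsto_scaleR r(2) ar)
  ultimately have eq: "adjoint (F' z0) m = l *\<^sub>R v"
    unfolding adjoint_scaleR[OF lin] by (rule LIMSEQ_unique)
  with cq[OF m] r(5) have "l \<noteq> 0" by auto
  show thesis
  proof (rule that)
    show "inverse l *\<^sub>R m \<in> normal_cone C (F z0)" using m r(4) by (intro normal_cone_scaleR) auto
    show "v = adjoint (F' z0) (inverse l *\<^sub>R m)"
      using \<open>l \<noteq> 0\<close> by (simp add: adjoint_scaleR[OF lin] eq)
  qed
qed

text \<open>Polar to \<open>tangent_cone_image\<close>: the adjoint shifts \<open>F'\<close> from
  the tangent vector to n.\<close>

lemma regular_normal_cone_chain_rule:
  fixes F :: "'a::euclidean_space \<Rightarrow> 'b::euclidean_space"
  assumes F: "(F has_derivative F') (at z)" and n: "n \<in> regular_normal_cone C (F z)"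
  shows "adjoint F' n \<in> regular_normal_cone (F -` C) z"
proof -
  have "n \<bullet> F' w \<le> 0" if "w \<in> tangent_cone (F -` C) z" for w
    using tangent_cone_image[OF F open_UNIV UNIV_I _ that, of C] n
    by (auto simp: regular_normal_cone_def)
  then show ?thesis
    using n adjoint_clauses(2)[OF has_derivative_linear[OF F]] by (simp add: regular_normal_cone_def)
qed

text \<open>Allows the chain rule to be applied at nearby points. Violating normals at points
  tending to z0, scaled to unit length, would accumulate at a violating unit normal at z0.\<close>

lemma constraint_qualification_stable:
  fixes F :: "'a::euclidean_space \<Rightarrow> 'b::euclidean_space"
  assumes F: "\<And>z. (F has_derivative F' z) (at z)" and cont: "\<And>h. continuous_on UNIV (\<lambda>z. F' z h)"
    and C: "closed C"
    and cq: "\<And>n. n \<in> normal_cone C (F z0) \<Longrightarrow> adjoint (F' z0) n = 0 \<Longrightarrow> n = 0"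
  shows "eventually (\<lambda>z. \<forall>n\<in>normal_cone C (F z). adjoint (F' z) n = 0 \<longrightarrow> n = 0) (nhds z0)"
proof (rule ccontr)
  assume neg: "\<not> ?thesis"
  have lin: "linear (F' z)" for z using F has_derivative_linear by blast
  have "\<exists>z n. dist z z0 < inverse (real (Suc k)) \<and> n \<in> normal_cone C (F z) \<and> adjoint (F' z) n = 0 \<and> norm n = 1" for k
  proof -
    obtain z n where z: "dist z z0 < inverse (real (Suc k))" "n \<in> normal_cone C (F z)"
      "adjoint (F' z) n = 0" "n \<noteq> 0"
      using neg unfolding eventually_nhds_metric
      by (metis inverse_positive_iff_positive of_nat_0_less_iff zero_less_Suc)
    then have "inverse (norm n) *\<^sub>R n \<in> normal_cone C (F z)" by (intro normal_cone_scaleR) auto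
    moreover have "adjoint (F' z) (inverse (norm n) *\<^sub>R n) = 0" "norm (inverse (norm n) *\<^sub>R n) = 1"
      using z by (simp_all add: adjoint_scaleR[OF lin])
    ultimately show ?thesis using z(1) by blast
  qed
  then obtain z n where zn: "\<And>k. dist (z k) z0 < inverse (real (Suc k))" "\<And>k. n k \<in> normal_cone C (F (z k))"
    "\<And>k. adjoint (F' (z k)) (n k) = 0" "\<And>k. norm (n k) = 1"
    by metis
  have z: "z \<longlonglongrightarrow> z0" by (rule tendsto_dist_inverse_Suc[OF tendsto_const zn(1)])
  have "n k \<in> sphere 0 1" for k using zn(4) by simp
  then obtain m r where r: "strict_mono r" "(n \<circ> r) \<longlonglongrightarrow> m"
    using seq_compactE[OF compact_imp_seq_compact[OF compact_sphere[of "0::'b" 1]], of n] by blast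
  have zr: "(\<lambda>k. z (r k)) \<longlonglongrightarrow> z0" and nr: "(\<lambda>k. n (r k)) \<longlonglongrightarrow> m"
    using LIMSEQ_subseq_LIMSEQ[OF z r(1)] r(2) by (simp_all add: o_def)
  have Fr: "(\<lambda>k. F (z (r k))) \<longlonglongrightarrow> F z0"
    by (rule isCont_tendsto_compose[OF has_derivative_continuous[OF F] zr])
  have "F (z k) \<in> C" for k using zn(2)[of k] by (simp add: normal_cone_def)
  then have "F z0 \<in> C" using closed_sequentially[OF C _ Fr] by blast
  then have "m \<in> normal_cone C (F z0)"
    by (rule normal_cone_closed_graph[OF zn(2) Fr nr])
  moreover have "(\<lambda>k. adjoint (F' (z (r k))) (n (r k))) \<longlonglongrightarrow> adjoint (F' z0) m"
    by (rule tendsto_adjoint_derivative[OF lin cont zr nr])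
  then have "adjoint (F' z0) m = 0" using LIMSEQ_unique[OF _ tendsto_const] by (simp add: zn(3))
  ultimately have "m = 0" by (rule cq)
  moreover have "norm m = 1" using LIMSEQ_unique[OF tendsto_norm[OF nr]] by (simp add: zn(4))
  ultimately show False by simp
qed

section \<open>Projections\<close>

lemma projI:
  assumes "y \<in> C" "\<And>z. z \<in> C \<Longrightarrow> norm (y - x) \<le> norm (z - x)"
  shows "y \<in> proj C x"
proof -
  have "C \<noteq> {}" using assms(1) by blast
  then have "norm (y - x) \<le> infdist x C"
    unfolding infdist_notempty[OF \<open>C \<noteq> {}\<close>]
  proof (rule cINF_greatest)
    show "norm (y - x) \<le> dist x a" if "a \<in> C" for a
      using assms(2)[OF that] by (simp add: dist_norm norm_minus_commute)
  qed
  moreover have "infdist x C \<le> norm (y - x)"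
    using infdist_le[OF assms(1), of x] by (simp add: dist_norm norm_minus_commute)
  ultimately have "infdist x C = norm (y - x)" by simp
  with assms(1) show ?thesis by (simp add: proj_def)
qed

lemma projD:
  assumes "y \<in> proj C x"
  shows "y \<in> C" "z \<in> C \<Longrightarrow> norm (y - x) \<le> norm (z - x)"
  using assms infdist_le[of z C x] by (auto simp: proj_def dist_norm norm_minus_commute)

lemma proj_iff: "y \<in> proj C x \<longleftrightarrow> y \<in> C \<and> (\<forall>z\<in>C. norm (y - x) \<le> norm (z - x))"
  by (auto intro: projI dest: projD)

lemma mem_proj_self: "x \<in> C \<Longrightarrow> x \<in> proj C x"
  by (simp add: proj_iff)

lemma proj_Times_UNIV: "(t, s) \<in> proj (C \<times> UNIV) (v, s') \<longleftrightarrow> t \<in> proj C v \<and> s = s'"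
proof
  assume L: "(t, s) \<in> proj (C \<times> UNIV) (v, s')"
  have t: "t \<in> C" using projD(1)[OF L] by simp
  \<comment> \<open>The competitor \<open>(z, s')\<close> matches the free component exactly; the
    choice \<open>z = t\<close> then gives \<open>s = s'\<close>.\<close>
  have le: "(norm (t - v))\<^sup>2 + (norm (s - s'))\<^sup>2 \<le> (norm (z - v))\<^sup>2" if "z \<in> C" for z
    using projD(2)[OF L, of "(z, s')"] that by (simp add: norm_Pair sqrt_le_D)
  have "s = s'" using le[OF t] by simp
  moreover have "norm (t - v) \<le> norm (z - v)" if "z \<in> C" for z
    by (rule power2_le_imp_le) (use le[OF that] \<open>s = s'\<close> in auto)
  ultimately show "t \<in> proj C v \<and> s = s'" using t by (simp add: proj_iff)
next
  assume R: "t \<in> proj C v \<and> s = s'"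
  then have "norm (t - v) \<le> norm (z - v)" if "z \<in> C" for z using projD(2)[of t C v z] that by simp
  then have "norm (t - v, 0::'b) \<le> norm (z - v, u - s')" if "z \<in> C" for z and u :: 'b
    using that unfolding norm_Pair by (intro real_sqrt_le_mono add_mono power_mono) auto
  then show "(t, s) \<in> proj (C \<times> UNIV) (v, s')"
    using R projD(1) by (auto simp: proj_iff)
qed

lemma proj_set_Times_UNIV:
  "(t, s) \<in> proj_set (C \<times> UNIV) Z \<longleftrightarrow> (\<exists>v. (v, s) \<in> Z \<and> t \<in> proj C v)"
  by (auto simp: proj_set_def proj_Times_UNIV) (auto simp: proj_Times_UNIV intro: rev_bexI)

text \<open>Lets an element of \<open>normal_map\<close> and its projection be rescaled
  together.\<close>

lemma proj_scaleR:
  assumes cone: "\<And>c w. w \<in> C \<Longrightarrow> 0 < c \<Longrightarrow> c *\<^sub>R w \<in> C" and y: "y \<in> proj C x" and c: "0 < c"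
  shows "c *\<^sub>R y \<in> proj C (c *\<^sub>R x)"
proof (rule projI)
  show "c *\<^sub>R y \<in> C" using projD(1)[OF y] c by (rule cone)
  fix z assume "z \<in> C"
  then have "inverse c *\<^sub>R z \<in> C" using c by (intro cone) auto
  from projD(2)[OF y this] have "c * norm (y - x) \<le> c * norm (inverse c *\<^sub>R z - x)"
    using c by (intro mult_left_mono) auto
  moreover have "c * norm u = norm (c *\<^sub>R u)" for u :: 'a using c by simp
  ultimately show "norm (c *\<^sub>R y - c *\<^sub>R x) \<le> norm (z - c *\<^sub>R x)"
    using c by (simp add: scaleR_diff_right del: norm_scaleR)
qed

section \<open>Smooth manifolds\<close>

lemma linear_blinfun_apply: "linear (blinfun_apply f)"
  by (rule bounded_linear.linear[OF blinfun.bounded_linear_right])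

text \<open>For a tangent space given as a kernel, this describes the residuals of projections onto
  it as adjoint images.\<close>

lemma orthogonal_comp_kernel:
  fixes f :: "'a::euclidean_space \<Rightarrow> 'b::euclidean_space"
  assumes "linear f"
  shows "{h. f h = 0}\<^sup>\<bottom> = range (adjoint f)"
proof -
  have "subspace (range (adjoint f))"
    using adjoint_linear[OF assms] by (intro linear_subspace_image) auto
  moreover have "{h. f h = 0} = (range (adjoint f))\<^sup>\<bottom>"
    using ker_orthogonal_comp_adjoint[OF assms] by (auto simp: vimage_def)
  ultimately show ?thesis by (simp add: orthogonal_comp_self)
qed

text \<open>Rank-nullity: f is injective on the orthogonal complement of its kernel and has its full
  range there.\<close>

lemma dim_kernel_plus_dim_range:
  fixes f :: "'a::euclidean_space \<Rightarrow> 'b::euclidean_space"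
  assumes f: "linear f"
  shows "dim {h. f h = 0} + dim (range f) = DIM('a)"
proof -
  interpret linear f by fact
  let ?K = "{h. f h = 0}"
  have K: "subspace ?K" by (rule linear_subspace_kernel[OF f])
  have L: "subspace (?K\<^sup>\<bottom>)" by (rule subspace_orthogonal_comp)
  have "dim {y \<in> UNIV. \<forall>x\<in>?K. orthogonal x y} + dim ?K = DIM('a)"
    using dim_subspace_orthogonal_to_vectors[OF K subspace_UNIV subset_UNIV] by simp
  then have "dim (?K\<^sup>\<bottom>) + dim ?K = DIM('a)" by (simp add: orthogonal_comp_def)
  moreover have "inj_on f (?K\<^sup>\<bottom>)"
  proof (rule inj_onI)
    fix x y assume xy: "x \<in> ?K\<^sup>\<bottom>" "y \<in> ?K\<^sup>\<bottom>" "f x = f y"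
    then have "x - y \<in> ?K \<inter> ?K\<^sup>\<bottom>" using subspace_diff[OF L] by (simp add: diff)
    then show "x = y" using orthogonal_Int_0[OF K] by auto
  qed
  then have "dim (f ` (?K\<^sup>\<bottom>)) = dim (?K\<^sup>\<bottom>)"
    using f L by (intro dim_image_eq) (simp_all add: span_eq_iff[THEN iffD2])
  moreover have "f ` (?K\<^sup>\<bottom>) = range f"
  proof (intro equalityI subsetI)
    fix y assume "y \<in> range f"
    then obtain x where x: "y = f x" by blast
    have "x \<in> ?K + ?K\<^sup>\<bottom>" using subspace_sum_orthogonal_comp[OF K] by simp
    then obtain a b where "x = a + b" "a \<in> ?K" "b \<in> ?K\<^sup>\<bottom>" by (rule set_plus_elim)
    then show "y \<in> f ` (?K\<^sup>\<bottom>)" using x by (auto simp: add)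
  qed auto
  ultimately show ?thesis by simp
qed

text \<open>The variational inequality of the projection is tested at both \<open>t + s\<close> and
  \<open>t - s\<close>.\<close>

lemma proj_subspace_orthogonal:
  assumes T: "subspace T" and t: "t \<in> proj T v"
  shows "v - t \<in> T\<^sup>\<bottom>"
proof -
  have le: "(v - t) \<bullet> (y - t) \<le> 0" if "y \<in> T" for y
    using any_closest_point_dot[of T t y v] subspace_imp_convex[OF T] closed_subspace[OF T] that t
      infdist_le[of _ T v]
    by (auto simp: proj_def dist_norm norm_minus_commute)
  have "t \<in> T" using t by (simp add: proj_def)
  have "(v - t) \<bullet> s = 0" if "s \<in> T" for s
    using le[of "t + s"] le[of "t - s"] subspace_add[OF T \<open>t \<in> T\<close> that] subspace_diff[OF T \<open>t \<in> T\<close> that] by simp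
  then show ?thesis by (simp add: orthogonal_comp_def orthogonal_def inner_commute)
qed

text \<open>
  Composing the defining map with a linear isomorphism of the kernel of its derivative onto the
  unused coordinates gives a local diffeomorphism that straightens \<open>W\<close>.
\<close>

lemma smooth_manifold_tangent_cone:
  fixes W :: "(real ^ 'm) set"
  assumes "smooth_manifold_around d' W wbar"
  obtains U and \<Phi>' :: "real ^ 'm \<Rightarrow> (real ^ 'm) \<Rightarrow>\<^sub>L (real ^ 'm)"
  where "open U" "wbar \<in> U" "continuous_on U \<Phi>'"
    "\<And>w. w \<in> W \<Longrightarrow> w \<in> U \<Longrightarrow> tangent_cone W w = {h. \<Phi>' w h = 0}"
proof -
  obtain I :: "'m set" and U and \<Phi> :: "real ^ 'm \<Rightarrow> real ^ 'm" where
    d': "d' \<le> CARD('m)" and I: "card I = CARD('m) - d'" and U: "open U" "wbar \<in> U" and "C1_on U \<Phi>" and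
    out: "\<And>w i. w \<in> U \<Longrightarrow> i \<notin> I \<Longrightarrow> \<Phi> w $ i = 0" and
    rk: "rank (matrix (frechet_derivative \<Phi> (at wbar))) = CARD('m) - d'" and
    W: "W \<inter> U = {w \<in> U. \<Phi> w = 0}"
    using assms unfolding smooth_manifold_around_def by blast
  obtain \<Phi>' where \<Phi>': "\<And>w. w \<in> U \<Longrightarrow> (\<Phi> has_derivative blinfun_apply (\<Phi>' w)) (at w)"
    and cont: "continuous_on U \<Phi>'"
    using \<open>C1_on U \<Phi>\<close> unfolding C1_on_def by blast
  \<comment> \<open>The components outside I vanish on all of the open set U, hence so do their
    derivatives.\<close>
  have out': "\<Phi>' w h $ i = 0" if "w \<in> U" "i \<notin> I" for w h i
  proof -
    have "((\<lambda>w. \<Phi> w $ i) has_derivative (\<lambda>h. \<Phi>' w h $ i)) (at w)"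
      using \<Phi>'[OF that(1)] by (rule bounded_linear.has_derivative[OF bounded_linear_vec_nth])
    moreover have "((\<lambda>w. \<Phi> w $ i) has_derivative (\<lambda>h. 0)) (at w)"
      by (rule has_derivative_transform_within_open[OF has_derivative_const[of 0] U(1) that(1)])
         (simp add: out that)
    ultimately show ?thesis using has_derivative_unique by metis
  qed
  let ?A = "blinfun_apply (\<Phi>' wbar)"
  have linA: "linear ?A" by (rule linear_blinfun_apply)
  \<comment> \<open>The subspace of the coordinates outside I, of dimension d'; the double negation
    is the form used by \<open>dim_substandard_cart\<close>.\<close>
  define V where "V = {y :: real ^ 'm. \<forall>i. i \<notin> - I \<longrightarrow> y $ i = 0}"
  have V: "subspace V" by (auto simp: V_def subspace_def)
  have dimV: "dim V = d'"
    using dim_substandard_cart[where 'a = real and d = "- I"] I d' card_Diff_subset[of I UNIV]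
    unfolding V_def Compl_eq_Diff_UNIV by (simp add: dim_vec_eq)
  have "frechet_derivative \<Phi> (at wbar) = ?A"
    using frechet_derivative_at[OF \<Phi>'[OF U(2)]] by simp
  then have "dim (range ?A) = CARD('m) - d'"
    using rk by (simp add: rank_dim_range matrix_works linear_matrix_vector_mul_eq linA)
  then have dimK: "dim {h. ?A h = 0} = dim V"
    using dim_kernel_plus_dim_range[OF linA] d' dimV by simp
  obtain f :: "real ^ 'm \<Rightarrow> real ^ 'm" where f: "linear f" "f ` {h. ?A h = 0} = V"
    "\<And>x. ?A x = 0 \<Longrightarrow> norm (f x) = norm x"
    by (rule isometries_subspaces[OF linear_subspace_kernel[OF linA] V dimK]) (rule that, assumption+, simp)
  \<comment> \<open>f maps into V only on the kernel. Composing with the coordinate projection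
    \<open>\<pi>\<close> makes B vanish in the coordinates of I everywhere, so that
    \<open>\<Psi>\<close> and \<open>\<Phi>\<close> agree there.\<close>
  define \<pi> where "\<pi> y = (\<chi> i. if i \<in> I then 0 else y $ i)" for y :: "real ^ 'm"
  have "linear (\<pi> \<circ> f)"
    by (rule linear_compose[OF f(1)], rule linearI) (simp_all add: \<pi>_def vec_eq_iff)
  then have bl: "bounded_linear (\<pi> \<circ> f)" by (simp add: linear_conv_bounded_linear)
  define B where "B = Blinfun (\<pi> \<circ> f)"
  have B: "blinfun_apply B h = \<pi> (f h)" for h
    unfolding B_def by (simp add: bounded_linear_Blinfun_apply[OF bl])
  define \<Psi> where "\<Psi> w = \<Phi> w + blinfun_apply B w" for w
  define \<Psi>' where "\<Psi>' w = \<Phi>' w + B" for w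
  have d\<Psi>: "(\<Psi> has_derivative blinfun_apply (\<Psi>' w)) (at w)" if "w \<in> U" for w
    unfolding \<Psi>_def[abs_def] \<Psi>'_def plus_blinfun.rep_eq
    by (intro has_derivative_add \<Phi>' that bounded_linear_imp_has_derivative blinfun.bounded_linear_right)
  have cont\<Psi>': "continuous_on U \<Psi>'"
    unfolding \<Psi>'_def by (intro continuous_on_add cont continuous_on_const)
  \<comment> \<open>A vector sent to 0 lies in the kernel of \<open>?A\<close>, by the coordinates
    in I and \<open>out'\<close>. The remaining coordinates then give \<open>f h = 0\<close>, and f
    is norm-preserving on that kernel.\<close>
  have "inj (blinfun_apply (\<Psi>' wbar))"
  proof (rule linear_injective_0[THEN iffD2, rule_format])
    show "linear (blinfun_apply (\<Psi>' wbar))" by (rule linear_blinfun_apply)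
    fix h assume "blinfun_apply (\<Psi>' wbar) h = 0"
    then have sum0: "?A h $ i + \<pi> (f h) $ i = 0" for i
      by (simp add: \<Psi>'_def plus_blinfun.rep_eq B vec_eq_iff)
    have "?A h $ i = 0" for i
      using sum0[of i] out'[OF U(2), of i h] by (cases "i \<in> I") (auto simp: \<pi>_def)
    then have A0: "?A h = 0" by (simp add: vec_eq_iff)
    then have "f h \<in> V" using f(2) by blast
    then have "f h $ i = 0" for i
      using sum0[of i] A0 by (cases "i \<in> I") (auto simp: \<pi>_def V_def)
    then have "f h = 0" by (simp add: vec_eq_iff)
    then show "h = 0" using f(3)[OF A0] by simp
  qed
  then obtain g0 where g0: "linear g0" "g0 \<circ> blinfun_apply (\<Psi>' wbar) = id"
    using linear_injective_left_inverse[OF linear_blinfun_apply] by blast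
  have invf: "Blinfun g0 o\<^sub>L \<Psi>' wbar = id_blinfun"
    using g0 by (intro blinfun_eqI)
      (simp add: bounded_linear_Blinfun_apply linear_conv_bounded_linear pointfree_idE)
  show thesis
  proof (rule inverse_function_theorem[where f = \<Psi>, OF U(1) _ cont\<Psi>' U(2) invf])
    show "(\<Psi> has_derivative blinfun_apply (\<Psi>' w)) (at w)" if "w \<in> U" for w
      by (rule d\<Psi>[OF that])
    fix U' X g g'
    assume U': "open U'" "U' \<subseteq> U" "wbar \<in> U'" and X: "open X" "\<Psi> wbar \<in> X" "homeomorphism U' X \<Psi> g"
      and g': "\<And>y. y \<in> X \<Longrightarrow> (g has_derivative g' y) (at y)"
        "\<And>y. y \<in> X \<Longrightarrow> g' y = inv (blinfun_apply (\<Psi>' (g y)))"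
        "\<And>y. y \<in> X \<Longrightarrow> bij (blinfun_apply (\<Psi>' (g y)))"
    show thesis
    proof (rule that[OF U'(1,3) continuous_on_subset[OF cont U'(2)]])
      fix w assume w: "w \<in> W" "w \<in> U'"
      have wU: "w \<in> U" using w U' by blast
      show "tangent_cone W w = {h. \<Phi>' w h = 0}"
      proof (intro equalityI subsetI CollectI)
        fix h assume "h \<in> tangent_cone W w"
        \<comment> \<open>Tangent vectors of W are mapped to tangent vectors of a single point,
          which are 0.\<close>
        moreover have "\<Phi> ` (W \<inter> U) \<subseteq> {0}" using W by auto
        ultimately have "\<Phi>' w h \<in> tangent_cone {0} (\<Phi> w)"
          using tangent_cone_image[OF \<Phi>'[OF wU] U(1) wU] by blast
        then obtain t v where tv: "\<And>k::nat. 0 < t k" "\<And>k. \<Phi> w + t k *\<^sub>R v k \<in> {0}" "\<Phi> w \<in> {0}" "v \<longlonglongrightarrow> \<Phi>' w h"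
          unfolding tangent_cone_def by blast
        have "v = (\<lambda>_. 0)"
        proof
          show "v k = 0" for k using tv(1)[of k] tv(2)[of k] tv(3) by auto
        qed
        with tv(4) show "\<Phi>' w h = 0" by (simp add: LIMSEQ_const_iff)
      next
        fix h assume "h \<in> {h. \<Phi>' w h = 0}"
        then have h: "\<Phi>' w h = 0" by simp
        \<comment> \<open>The affine subspace through \<open>\<Psi> w\<close> onto which W is
          straightened. Near \<open>\<Psi> w\<close> the inverse g maps it into W, and for h in the
          kernel \<open>\<Psi>' w h\<close> is one of its directions, which the derivative of g
          carries back to h.\<close>
        define Y where "Y = {y. \<forall>i\<in>I. (y - \<Psi> w) $ i = 0}"
        have wX: "\<Psi> w \<in> X" and gw: "g (\<Psi> w) = w"
          using X(3) w(2) by (auto simp: homeomorphism_def)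
        have \<Psi>I: "\<Psi> w' $ i = \<Phi> w' $ i" if "i \<in> I" for w' i
          using that by (simp add: \<Psi>_def B \<pi>_def)
        have "g ` (Y \<inter> X) \<subseteq> W"
        proof
          fix w' assume "w' \<in> g ` (Y \<inter> X)"
          then obtain y where y: "y \<in> Y" "y \<in> X" "w' = g y" by blast
          then have w': "w' \<in> U'" "\<Psi> w' = y" using X(3) by (auto simp: homeomorphism_def)
          have "\<Phi> w = 0" using W w(1) wU by blast
          have "\<Phi> w' $ i = 0" for i
          proof (cases "i \<in> I")
            case True
            then have "\<Psi> w' $ i = \<Psi> w $ i" using y(1) w'(2) by (auto simp: Y_def)
            then show ?thesis using True \<open>\<Phi> w = 0\<close> by (simp add: \<Psi>I)
          qed (use out w' U' in blast)
          then have "\<Phi> w' = 0" by (simp add: vec_eq_iff)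
          then show "w' \<in> W" using W w' U' by blast
        qed
        moreover have "blinfun_apply (\<Psi>' w) h \<in> tangent_cone Y (\<Psi> w)"
          by (rule tangent_cone_direction)
             (auto simp: Y_def \<Psi>'_def plus_blinfun.rep_eq h B \<pi>_def)
        ultimately have "g' (\<Psi> w) (blinfun_apply (\<Psi>' w) h) \<in> tangent_cone W (g (\<Psi> w))"
          using tangent_cone_image[OF g'(1)[OF wX] X(1) wX] by blast
        moreover have "g' (\<Psi> w) (blinfun_apply (\<Psi>' w) h) = h"
          using g'(2,3)[OF wX] by (simp add: gw bij_is_inj)
        ultimately show "h \<in> tangent_cone W w" by (simp add: gw)
      qed
    qed
  qed
qed

text \<open>Tangent vectors of C have their w-component tangent to W, where the range of the adjoint
  is orthogonal to them. Regular normals may therefore be shifted by this range, and continuity of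
  \<open>\<Phi>'\<close> carries the shift to limiting normals.\<close>

lemma normal_cone_add_adjoint:
  fixes \<Phi>' :: "'a::euclidean_space \<Rightarrow> 'a \<Rightarrow>\<^sub>L 'e::euclidean_space"
    and C :: "(('a \<times> 'b::euclidean_space) \<times> 'c::euclidean_space) set"
  assumes C: "C \<subseteq> (W \<times> UNIV) \<times> UNIV" and U: "open U" "w \<in> U" "continuous_on U \<Phi>'"
    and tan: "\<And>w. w \<in> W \<Longrightarrow> w \<in> U \<Longrightarrow> tangent_cone W w \<subseteq> {h. \<Phi>' w h = 0}"
    and n: "((a, b), c) \<in> normal_cone C ((w, x), u)"
  shows "((a + adjoint (\<Phi>' w) m, b), c) \<in> normal_cone C ((w, x), u)"
proof -
  let ?p = "((w, x), u)"
  obtain z v where z: "?p \<in> C" "\<And>k::nat. z k \<in> C" "\<And>k. v k \<in> regular_normal_cone C (z k)"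
    "z \<longlonglongrightarrow> ?p" "v \<longlonglongrightarrow> ((a, b), c)"
    using n by (elim normal_coneE) metis
  have w: "(\<lambda>k. fst (fst (z k))) \<longlonglongrightarrow> w"
    using tendsto_fst[OF tendsto_fst[OF z(4)]] by simp
  then have "eventually (\<lambda>k. fst (fst (z k)) \<in> U) sequentially"
    using U(1,2) by (rule topological_tendstoD)
  then obtain N where N: "\<And>k. k \<ge> N \<Longrightarrow> fst (fst (z k)) \<in> U"
    by (auto simp: eventually_sequentially)
  \<comment> \<open>The operator is taken at the base point of \<open>z k\<close>, not at w, because
    the shifted vector has to be a regular normal at \<open>z k\<close>.\<close>
  define y where "y k = adjoint (\<Phi>' (fst (fst (z k)))) m" for k
  have "isCont \<Phi>' w" using U continuous_on_eq_continuous_at by blast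
  then have "(\<lambda>k. \<Phi>' (fst (fst (z k)))) \<longlonglongrightarrow> \<Phi>' w" using w by (rule isCont_tendsto_compose)
  then have y: "y \<longlonglongrightarrow> adjoint (\<Phi>' w) m"
    unfolding y_def
    by (intro tendsto_adjoint linear_blinfun_apply blinfun.tendsto tendsto_const)
  have "(\<lambda>k. v k + ((y k, 0), 0)) \<longlonglongrightarrow> ((a, b), c) + ((adjoint (\<Phi>' w) m, 0), 0)"
    by (intro tendsto_add z(5) tendsto_Pair y tendsto_const)
  then have "(\<lambda>k. v (k + N) + ((y (k + N), 0), 0)) \<longlonglongrightarrow> ((a + adjoint (\<Phi>' w) m, b), c)"
    by (intro LIMSEQ_ignore_initial_segment[where f = "\<lambda>k. v k + ((y k, 0), 0)"]) simp
  moreover have "(\<lambda>k. z (k + N)) \<longlonglongrightarrow> ?p" using z(4) by (rule LIMSEQ_ignore_initial_segment)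
  moreover have "v (k + N) + ((y (k + N), 0), 0) \<in> regular_normal_cone C (z (k + N))" for k
  proof -
    obtain w' x' u' where z': "z (k + N) = ((w', x'), u')" by (metis surj_pair)
    then have wU: "w' \<in> U" using N[of "k + N"] by simp
    have wW: "w' \<in> W" using z(2)[of "k + N"] C z' by auto
    have "(v (k + N) + ((y (k + N), 0), 0)) \<bullet> h \<le> 0" if h: "h \<in> tangent_cone C (z (k + N))" for h
    proof -
      have "fst (fst h) \<in> tangent_cone W w'"
        using tangent_cone_fst_fst[OF C] h z' by metis
      then have "\<Phi>' w' (fst (fst h)) = 0" using tan[OF wW wU] by blast
      then have "((y (k + N), 0), 0) \<bullet> h = 0"
        by (simp add: inner_prod_def y_def z' adjoint_clauses[OF linear_blinfun_apply])
      moreover have "v (k + N) \<bullet> h \<le> 0" using z(3)[of "k + N"] h by (simp add: regular_normal_cone_def)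
      ultimately show ?thesis by (simp add: inner_add_left)
    qed
    then show ?thesis using z(2) by (simp add: regular_normal_cone_def)
  qed
  ultimately show ?thesis using z(1) by (intro normal_coneI)
qed

section \<open>Parametric generalized equations\<close>

lemma C1_on_frechet_derivative:
  fixes G :: "'a::euclidean_space \<Rightarrow> 'b::euclidean_space"
  assumes "C1_on UNIV G"
  shows "(G has_derivative frechet_derivative G (at z)) (at z)"
    and "continuous_on UNIV (\<lambda>z. frechet_derivative G (at z) h)"
proof -
  obtain D where D: "\<And>z. (G has_derivative blinfun_apply (D z)) (at z)" "continuous_on UNIV D"
    using assms unfolding C1_on_def by blast
  have eq: "frechet_derivative G (at z) = blinfun_apply (D z)" for z
    using frechet_derivative_at[OF D(1)] by simp
  show "(G has_derivative frechet_derivative G (at z)) (at z)" using D(1) by (simp add: eq)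
  show "continuous_on UNIV (\<lambda>z. frechet_derivative G (at z) h)"
    unfolding eq by (intro blinfun.continuous_on D(2) continuous_on_const)
qed

section \<open>The graph of the solution map as a preimage\<close>

text \<open>The same construction applied to the derivative of G yields the derivative of
  \<open>embed G\<close>, so it serves for both.\<close>

definition embed :: "('a \<Rightarrow> 'b::uminus) \<Rightarrow> 'a \<Rightarrow> 'a \<times> 'b" where
  "embed G z = (z, - G z)"

lemma has_derivative_embed:
  "(G has_derivative G') (at z) \<Longrightarrow> (embed G has_derivative embed G') (at z)"
  unfolding embed_def[abs_def] by (intro has_derivative_Pair has_derivative_minus has_derivative_ident)

text \<open>The sign of y cancels the sign in \<open>embed\<close>, which produces the sum in
  \<open>normal_map\<close>.\<close>

lemma adjoint_embed:
  fixes f :: "'a::euclidean_space \<Rightarrow> 'b::euclidean_space"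
  assumes "linear f"
  shows "adjoint (embed f) (a, - y) = a + adjoint f y"
proof -
  have "adjoint (embed f) = (\<lambda>(a, b). a - adjoint f b)"
    by (rule adjoint_unique)
       (auto simp: embed_def adjoint_works[OF assms] inner_diff_right inner_commute)
  then show ?thesis
    using linear_neg[OF adjoint_linear[OF assms]] by simp
qed

lemma gph_mrestrict_Times_UNIV:
  "gph (mrestrict M (W \<times> UNIV)) = gph M \<inter> (W \<times> UNIV) \<times> UNIV"
  by (auto simp: gph_def mrestrict_def split: if_splits)

lemma closed_gph_mrestrict:
  fixes M :: "'a::euclidean_space \<times> 'b::euclidean_space \<Rightarrow> 'c::euclidean_space set"
  assumes "closed (gph M)" "closed W"
  shows "closed (gph (mrestrict M (W \<times> UNIV)))"
  unfolding gph_mrestrict_Times_UNIV by (intro closed_Int closed_Times assms closed_UNIV)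

lemma gph_sol_map:
  fixes G :: "'a \<times> 'b \<Rightarrow> 'c::ab_group_add"
  shows "gph (mrestrict (sol_map G M) W) = embed G -` gph (mrestrict M (W \<times> UNIV))"
proof -
  have "0 = G p + z \<longleftrightarrow> z = - G p" for p and z :: 'c
    by (metis add.commute add_eq_0_iff)
  then show ?thesis
    by (auto simp: gph_def mrestrict_def sol_map_def embed_def image_iff split: if_splits)
qed

lemma mem_normal_map:
  "p \<in> normal_map G M W w x y \<longleftrightarrow>
    (p - adjoint (frechet_derivative G (at (w, x))) y, - y)
      \<in> normal_cone (gph (mrestrict M (W \<times> UNIV))) ((w, x), - G (w, x))"
proof
  assume "(p - adjoint (frechet_derivative G (at (w, x))) y, - y)
      \<in> normal_cone (gph (mrestrict M (W \<times> UNIV))) ((w, x), - G (w, x))"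
  then show "p \<in> normal_map G M W w x y"
    unfolding normal_map_def coderivative_def
    by (intro image_eqI[where x = "p - adjoint (frechet_derivative G (at (w, x))) y"]) auto
qed (auto simp: normal_map_def coderivative_def)

lemma normal_map_eq_adjoint_embed:
  assumes G: "C1_on UNIV G"
  shows "(\<exists>y. p \<in> normal_map G M W w x y) \<longleftrightarrow>
    (\<exists>n \<in> normal_cone (gph (mrestrict M (W \<times> UNIV))) (embed G (w, x)).
      p = adjoint (embed (frechet_derivative G (at (w, x)))) n)"
proof
  have lin: "linear (frechet_derivative G (at (w, x)))"
    using C1_on_frechet_derivative(1)[OF G] has_derivative_linear by blast
  show "\<exists>n \<in> normal_cone (gph (mrestrict M (W \<times> UNIV))) (embed G (w, x)).
      p = adjoint (embed (frechet_derivative G (at (w, x)))) n"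
    if p: "\<exists>y. p \<in> normal_map G M W w x y"
  proof -
    obtain y where "p \<in> normal_map G M W w x y" using p by blast
    then show ?thesis
      unfolding mem_normal_map embed_def[of G] by (rule rev_bexI) (simp add: adjoint_embed[OF lin])
  qed
  show "\<exists>y. p \<in> normal_map G M W w x y"
    if n: "\<exists>n \<in> normal_cone (gph (mrestrict M (W \<times> UNIV))) (embed G (w, x)).
      p = adjoint (embed (frechet_derivative G (at (w, x)))) n"
  proof -
    obtain n where n: "n \<in> normal_cone (gph (mrestrict M (W \<times> UNIV))) (embed G (w, x))"
      "p = adjoint (embed (frechet_derivative G (at (w, x)))) n"
      using n by blast
    obtain a b where "n = (a, b)" by (cases n)
    with n have ab: "(a, b) \<in> normal_cone (gph (mrestrict M (W \<times> UNIV))) (embed G (w, x))"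
      "p = adjoint (embed (frechet_derivative G (at (w, x)))) (a, b)"
      by simp_all
    have "p = a + adjoint (frechet_derivative G (at (w, x))) (- b)"
      using ab(2) adjoint_embed[OF lin, of a "- b"] by simp
    then have "p \<in> normal_map G M W w x (- b)"
      using ab(1) by (simp add: mem_normal_map embed_def)
    then show ?thesis ..
  qed
qed

lemma normal_map_scaleR:
  assumes G: "C1_on UNIV G" and p: "p \<in> normal_map G M W w x y" and c: "0 \<le> c"
  shows "c *\<^sub>R p \<in> normal_map G M W w x (c *\<^sub>R y)"
proof -
  have lin: "linear (frechet_derivative G (at (w, x)))"
    using C1_on_frechet_derivative(1)[OF G] has_derivative_linear by blast
  show ?thesis
    using normal_cone_scaleR[OF p[unfolded mem_normal_map] c]
    unfolding mem_normal_map by (simp add: adjoint_scaleR[OF lin] scaleR_diff_right)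
qed

text \<open>Combines the closed graph of the normal cone with the continuity of the adjoint
  derivative; closedness of the set keeps the limit base point in it.\<close>

lemma normal_map_closed_graph:
  fixes G :: "'a::euclidean_space \<times> 'b::euclidean_space \<Rightarrow> 'c::euclidean_space"
  assumes G: "C1_on UNIV G" and C: "closed (gph (mrestrict M (W \<times> UNIV)))"
    and p: "\<And>k. p k \<in> normal_map G M W (w k) (x k) (y k)"
    and lim: "w \<longlonglongrightarrow> w0" "x \<longlonglongrightarrow> x0" "y \<longlonglongrightarrow> y0" "p \<longlonglongrightarrow> p0"
  shows "p0 \<in> normal_map G M W w0 x0 y0"
proof -
  note G' = C1_on_frechet_derivative[OF G]
  have lin: "linear (frechet_derivative G (at z))" for z
    using G'(1) has_derivative_linear by blast
  have wx: "(\<lambda>k. (w k, x k)) \<longlonglongrightarrow> (w0, x0)" by (intro tendsto_Pair lim)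
  have "(\<lambda>k. - G (w k, x k)) \<longlonglongrightarrow> - G (w0, x0)"
    by (intro tendsto_minus isCont_tendsto_compose[OF has_derivative_continuous[OF G'(1)] wx])
  then have e: "(\<lambda>k. ((w k, x k), - G (w k, x k))) \<longlonglongrightarrow> ((w0, x0), - G (w0, x0))"
    by (intro tendsto_Pair wx)
  have "(\<lambda>k. adjoint (frechet_derivative G (at (w k, x k))) (y k))
      \<longlonglongrightarrow> adjoint (frechet_derivative G (at (w0, x0))) y0"
    by (rule tendsto_adjoint_derivative[OF lin G'(2) wx lim(3)])
  then have n: "(\<lambda>k. (p k - adjoint (frechet_derivative G (at (w k, x k))) (y k), - y k))
      \<longlonglongrightarrow> (p0 - adjoint (frechet_derivative G (at (w0, x0))) y0, - y0)"
    by (intro tendsto_Pair tendsto_diff tendsto_minus lim)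
  have "((w k, x k), - G (w k, x k)) \<in> gph (mrestrict M (W \<times> UNIV))" for k
    using p[of k] by (simp add: mem_normal_map normal_cone_def)
  then have "((w0, x0), - G (w0, x0)) \<in> gph (mrestrict M (W \<times> UNIV))"
    using closed_sequentially[OF C _ e] by blast
  then show ?thesis
    unfolding mem_normal_map by (rule normal_cone_closed_graph[OF p[unfolded mem_normal_map] e n])
qed

section \<open>Outer limits in terms of sequences\<close>

lemma outer_limitE:
  assumes "u \<in> outer_limit D zbar A"
  obtains z v where "\<forall>k::nat. z k \<in> D" "\<forall>k. v k \<in> A (z k)" "z \<longlonglongrightarrow> zbar" "v \<longlonglongrightarrow> u"
proof -
  have "\<exists>z v. (\<forall>k::nat. z k \<in> D \<and> v k \<in> A (z k)) \<and> z \<longlonglongrightarrow> zbar \<and> v \<longlonglongrightarrow> u"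
    using assms unfolding outer_limit_def by simp
  then show thesis using that by blast
qed

lemma outer_limitI:
  assumes "\<And>k::nat. z k \<in> D" "\<And>k. v k \<in> A (z k)" "z \<longlonglongrightarrow> zbar" "v \<longlonglongrightarrow> u"
  shows "u \<in> outer_limit D zbar A"
  using assms unfolding outer_limit_def by blast

text \<open>Brought to the same sequential form as \<open>mem_outer_limit_normal_map\<close>; the
  two then differ only in whether the multipliers have to converge.\<close>

lemma mem_upper_outer:
  "t \<in> upper_outer G M W wbar xbar r \<longleftrightarrow>
    (\<exists>w x v s y t'. (\<forall>k. (w k, x k) \<in> gph (mrestrict (sol_map G M) W) \<and>
        (v k, s k) \<in> normal_map G M W (w k) (x k) (y k) \<and> t' k \<in> proj (tangent_cone W (w k)) (v k)) \<and>
      w \<longlonglongrightarrow> wbar \<and> x \<longlonglongrightarrow> xbar \<and> t' \<longlonglongrightarrow> t \<and> s \<longlonglongrightarrow> - r)"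
  (is "?L \<longleftrightarrow> ?R")
proof
  assume ?L
  then obtain z t' where z: "\<forall>k. z k \<in> gph (mrestrict (sol_map G M) W) \<times> UNIV"
      "\<forall>k. t' k \<in> (\<lambda>((w, x), r').
        \<Union>y. proj_set (tangent_cone W w) {v. (v, - r') \<in> normal_map G M W w x y}) (z k)"
    and lim: "z \<longlonglongrightarrow> ((wbar, xbar), r)" "t' \<longlonglongrightarrow> t"
    unfolding upper_outer_def by (rule outer_limitE)
  define w x r' where "w k = fst (fst (z k))" and "x k = snd (fst (z k))" and "r' k = snd (z k)" for k
  have zk: "z k = ((w k, x k), r' k)" for k by (simp add: w_def x_def r'_def)
  have lims: "w \<longlonglongrightarrow> wbar" "x \<longlonglongrightarrow> xbar" "r' \<longlonglongrightarrow> r"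
    using tendsto_fst[OF tendsto_fst[OF lim(1)]] tendsto_snd[OF tendsto_fst[OF lim(1)]] tendsto_snd[OF lim(1)]
    unfolding w_def[abs_def] x_def[abs_def] r'_def[abs_def] by simp_all
  have "\<forall>k. \<exists>v y. (v, - r' k) \<in> normal_map G M W (w k) (x k) y \<and> t' k \<in> proj (tangent_cone W (w k)) v"
  proof
    fix k
    have "t' k \<in> (\<Union>y. proj_set (tangent_cone W (w k)) {v. (v, - r' k) \<in> normal_map G M W (w k) (x k) y})"
      using z(2)[rule_format, of k] unfolding zk[of k] by simp
    then show "\<exists>v y. (v, - r' k) \<in> normal_map G M W (w k) (x k) y \<and> t' k \<in> proj (tangent_cone W (w k)) v"
      unfolding proj_set_def by blast
  qed
  then obtain v y where v: "\<And>k. (v k, - r' k) \<in> normal_map G M W (w k) (x k) (y k)"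
    "\<And>k. t' k \<in> proj (tangent_cone W (w k)) (v k)"
    by metis
  have E: "(w k, x k) \<in> gph (mrestrict (sol_map G M) W)" for k
    using z(1)[rule_format, of k] unfolding zk by simp
  show ?R
    using lims lim(2) tendsto_minus[OF lims(3)] v E
    by (intro exI[of _ w] exI[of _ x] exI[of _ v] exI[of _ "\<lambda>k. - r' k"] exI[of _ y] exI[of _ t'] conjI allI)
next
  assume ?R
  then obtain w x v s y t' where *: "\<And>k. (w k, x k) \<in> gph (mrestrict (sol_map G M) W)"
    "\<And>k. (v k, s k) \<in> normal_map G M W (w k) (x k) (y k)"
    "\<And>k. t' k \<in> proj (tangent_cone W (w k)) (v k)"
    and lims: "w \<longlonglongrightarrow> wbar" "x \<longlonglongrightarrow> xbar" "t' \<longlonglongrightarrow> t" "s \<longlonglongrightarrow> - r"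
    by blast
  have "(\<lambda>k. ((w k, x k), - s k)) \<longlonglongrightarrow> ((wbar, xbar), r)"
    using tendsto_minus[OF lims(4)] by (intro tendsto_Pair lims) simp
  moreover have "t' k \<in> (\<Union>y. proj_set (tangent_cone W (w k)) {v'. (v', s k) \<in> normal_map G M W (w k) (x k) y})" for k
    using *(2,3)[of k] unfolding proj_set_def by blast
  ultimately show ?L
    unfolding upper_outer_def outer_limit_def using * lims(3)
    by (intro CollectI exI[of _ "\<lambda>k. ((w k, x k), - s k)"] exI[of _ t']) auto
qed

text \<open>General t and q, so that it serves both the strong qualification, where they are 0, and
  \<open>upper_inner\<close>, where q is \<open>- r\<close>.\<close>

lemma mem_outer_limit_normal_map:
  "(t, q) \<in> outer_limit (gph (mrestrict (sol_map G M) W) \<times> UNIV) ((wbar, xbar), y)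
      (\<lambda>((w, x), y'). proj_set (tangent_cone W w \<times> UNIV) (normal_map G M W w x y')) \<longleftrightarrow>
    (\<exists>w x v s y' t'. (\<forall>k. (w k, x k) \<in> gph (mrestrict (sol_map G M) W) \<and>
        (v k, s k) \<in> normal_map G M W (w k) (x k) (y' k) \<and> t' k \<in> proj (tangent_cone W (w k)) (v k)) \<and>
      w \<longlonglongrightarrow> wbar \<and> x \<longlonglongrightarrow> xbar \<and> y' \<longlonglongrightarrow> y \<and> t' \<longlonglongrightarrow> t \<and> s \<longlonglongrightarrow> q)"
  (is "?L \<longleftrightarrow> ?R")
proof
  assume ?L
  then obtain z p where z: "\<forall>k. z k \<in> gph (mrestrict (sol_map G M) W) \<times> UNIV"
      "\<forall>k. p k \<in> (\<lambda>((w, x), y'). proj_set (tangent_cone W w \<times> UNIV) (normal_map G M W w x y')) (z k)"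
    and lim: "z \<longlonglongrightarrow> ((wbar, xbar), y)" "p \<longlonglongrightarrow> (t, q)"
    by (rule outer_limitE)
  define w x y' where "w k = fst (fst (z k))" and "x k = snd (fst (z k))" and "y' k = snd (z k)" for k
  have zk: "z k = ((w k, x k), y' k)" for k by (simp add: w_def x_def y'_def)
  have lims: "w \<longlonglongrightarrow> wbar" "x \<longlonglongrightarrow> xbar" "y' \<longlonglongrightarrow> y"
    using tendsto_fst[OF tendsto_fst[OF lim(1)]] tendsto_snd[OF tendsto_fst[OF lim(1)]] tendsto_snd[OF lim(1)]
    unfolding w_def[abs_def] x_def[abs_def] y'_def[abs_def] by simp_all
  have pk: "(fst (p k), snd (p k)) \<in> proj_set (tangent_cone W (w k) \<times> UNIV) (normal_map G M W (w k) (x k) (y' k))" for k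
    using z(2)[rule_format, of k] unfolding zk by simp
  then have "\<forall>k. \<exists>v. (v, snd (p k)) \<in> normal_map G M W (w k) (x k) (y' k) \<and> fst (p k) \<in> proj (tangent_cone W (w k)) v"
    unfolding proj_set_Times_UNIV by blast
  then obtain v where v: "\<And>k. (v k, snd (p k)) \<in> normal_map G M W (w k) (x k) (y' k)"
    "\<And>k. fst (p k) \<in> proj (tangent_cone W (w k)) (v k)"
    by metis
  have E: "(w k, x k) \<in> gph (mrestrict (sol_map G M) W)" for k
    using z(1)[rule_format, of k] unfolding zk by simp
  have "(\<lambda>k. fst (p k)) \<longlonglongrightarrow> t" "(\<lambda>k. snd (p k)) \<longlonglongrightarrow> q"
    using tendsto_fst[OF lim(2)] tendsto_snd[OF lim(2)] by simp_all
  with v E lims show ?R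
    by (intro exI[of _ w] exI[of _ x] exI[of _ v] exI[of _ "\<lambda>k. snd (p k)"] exI[of _ y'] exI[of _ "\<lambda>k. fst (p k)"] conjI allI)
next
  assume ?R
  then obtain w x v s y' t' where *: "\<And>k. (w k, x k) \<in> gph (mrestrict (sol_map G M) W)"
    "\<And>k. (v k, s k) \<in> normal_map G M W (w k) (x k) (y' k)"
    "\<And>k. t' k \<in> proj (tangent_cone W (w k)) (v k)"
    and lims: "w \<longlonglongrightarrow> wbar" "x \<longlonglongrightarrow> xbar" "y' \<longlonglongrightarrow> y" "t' \<longlonglongrightarrow> t" "s \<longlonglongrightarrow> q"
    by blast
  have "(\<lambda>k. ((w k, x k), y' k)) \<longlonglongrightarrow> ((wbar, xbar), y)" "(\<lambda>k. (t' k, s k)) \<longlonglongrightarrow> (t, q)"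
    by (intro tendsto_Pair lims)+
  moreover have "(t' k, s k) \<in> proj_set (tangent_cone W (w k) \<times> UNIV) (normal_map G M W (w k) (x k) (y' k))" for k
    unfolding proj_set_Times_UNIV using *(2,3) by blast
  ultimately show ?L
    unfolding outer_limit_def using *
    by (intro CollectI exI[of _ "\<lambda>k. ((w k, x k), y' k)"] exI[of _ "\<lambda>k. (t' k, s k)"]) auto
qed

lemma upper_inner_eq:
  fixes G :: "'a::euclidean_space \<times> 'b::euclidean_space \<Rightarrow> 'c::euclidean_space"
  assumes G: "C1_on UNIV G"
  shows "upper_inner G M W wbar xbar r =
    {t. \<exists>y. (t, - r) \<in> outer_limit (gph (mrestrict (sol_map G M) W) \<times> UNIV) ((wbar, xbar), y)
      (\<lambda>((w, x), y'). proj_set (tangent_cone W w \<times> UNIV) (normal_map G M W w x y'))}"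
proof -
  let ?E = "gph (mrestrict (sol_map G M) W)"
  let ?D = "{((w, x), u). u = - G (w, x) \<and> ((w, x), u) \<in> gph (mrestrict M (W \<times> UNIV))}"
  let ?A = "\<lambda>((w, x), y'). proj_set (tangent_cone W w \<times> UNIV) (normal_map G M W w x y')"
  let ?B = "\<lambda>(((w, x), u), y'). proj_set (tangent_cone W w \<times> UNIV) (normal_map G M W w x y')"
  have D: "((w, x), u) \<in> ?D \<longleftrightarrow> u = - G (w, x) \<and> (w, x) \<in> ?E" for w x u
    unfolding gph_sol_map by (auto simp: embed_def)
  have AB: "?B ((p, u), y) = ?A (p, y)" for p u y by (cases p) simp
  have "outer_limit (?D \<times> UNIV) (((wbar, xbar), - G (wbar, xbar)), y) ?B
      = outer_limit (?E \<times> UNIV) ((wbar, xbar), y) ?A" for y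
  proof (intro equalityI subsetI)
    fix q assume "q \<in> outer_limit (?D \<times> UNIV) (((wbar, xbar), - G (wbar, xbar)), y) ?B"
    then obtain z v where z: "\<forall>k. z k \<in> ?D \<times> UNIV" "\<forall>k. v k \<in> ?B (z k)"
      and lim: "z \<longlonglongrightarrow> (((wbar, xbar), - G (wbar, xbar)), y)" "v \<longlonglongrightarrow> q"
      by (rule outer_limitE)
    define z' where "z' k = (fst (fst (z k)), snd (z k))" for k
    show "q \<in> outer_limit (?E \<times> UNIV) ((wbar, xbar), y) ?A"
    proof (rule outer_limitI[OF _ _ _ lim(2)])
      fix k
      obtain w x u y' where zk: "z k = (((w, x), u), y')" by (metis surj_pair)
      then show "z' k \<in> ?E \<times> UNIV" "v k \<in> ?A (z' k)"
        using z(1)[rule_format, of k] z(2)[rule_format, of k] D[of w x u] by (auto simp: z'_def)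
    next
      show "z' \<longlonglongrightarrow> ((wbar, xbar), y)"
        using tendsto_Pair[OF tendsto_fst[OF tendsto_fst[OF lim(1)]] tendsto_snd[OF lim(1)]]
        unfolding z'_def[abs_def] by simp
    qed
  next
    fix q assume "q \<in> outer_limit (?E \<times> UNIV) ((wbar, xbar), y) ?A"
    then obtain z v where z: "\<forall>k. z k \<in> ?E \<times> UNIV" "\<forall>k. v k \<in> ?A (z k)"
      and lim: "z \<longlonglongrightarrow> ((wbar, xbar), y)" "v \<longlonglongrightarrow> q"
      by (rule outer_limitE)
    define z' where "z' k = ((fst (z k), - G (fst (z k))), snd (z k))" for k
    show "q \<in> outer_limit (?D \<times> UNIV) (((wbar, xbar), - G (wbar, xbar)), y) ?B"
    proof (rule outer_limitI[OF _ _ _ lim(2)])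
      fix k
      obtain w x y' where zk: "z k = ((w, x), y')" by (metis surj_pair)
      then show "z' k \<in> ?D \<times> UNIV" "v k \<in> ?B (z' k)"
        using z(1)[rule_format, of k] z(2)[rule_format, of k] D[of w x "- G (w, x)"] by (simp_all add: z'_def)
    next
      have 1: "(\<lambda>k. fst (z k)) \<longlonglongrightarrow> (wbar, xbar)" using tendsto_fst[OF lim(1)] by simp
      have "(\<lambda>k. G (fst (z k))) \<longlonglongrightarrow> G (wbar, xbar)"
        by (rule isCont_tendsto_compose[OF has_derivative_continuous[OF C1_on_frechet_derivative(1)[OF G]] 1])
      then show "z' \<longlonglongrightarrow> (((wbar, xbar), - G (wbar, xbar)), y)"
        using tendsto_snd[OF lim(1)] unfolding z'_def[abs_def]
        by (intro tendsto_Pair tendsto_minus 1) simp_all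
    qed
  qed
  then show ?thesis unfolding upper_inner_def by simp
qed

section \<open>The upper estimate under the basic qualification\<close>

text \<open>For \<open>n = (a, b)\<close> the multiplier is \<open>y = - b\<close>. Once b is 0, the
  vanishing adjoint image leaves a = 0.\<close>

lemma basic_cq_imp:
  fixes G :: "'a::euclidean_space \<times> 'b::euclidean_space \<Rightarrow> 'c::euclidean_space"
  assumes G: "C1_on UNIV G" and cq: "basic_cq G M W wbar xbar"
    and n: "n \<in> normal_cone (gph (mrestrict M (W \<times> UNIV))) (embed G (wbar, xbar))"
    and zero: "adjoint (embed (frechet_derivative G (at (wbar, xbar)))) n = 0"
  shows "n = 0"
proof -
  have lin: "linear (frechet_derivative G (at (wbar, xbar)))"
    using C1_on_frechet_derivative(1)[OF G] has_derivative_linear by blast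
  obtain a b where ab: "n = (a, b)" by (cases n)
  have a: "a + adjoint (frechet_derivative G (at (wbar, xbar))) (- b) = 0"
    using zero adjoint_embed[OF lin, of a "- b"] by (simp add: ab)
  then have "a = 0 - adjoint (frechet_derivative G (at (wbar, xbar))) (- b)"
    by (simp add: eq_neg_iff_add_eq_0)
  then have "(0, 0) \<in> normal_map G M W wbar xbar (- b)"
    using n unfolding mem_normal_map ab by (simp add: embed_def zero_prod_def)
  then have "b = 0" using cq unfolding basic_cq_def by fastforce
  then show ?thesis
    using a linear_0[OF adjoint_linear[OF lin]] by (simp add: ab zero_prod_def)
qed

text \<open>The chain rule is applied before projecting, at each point of the sequence. It
  represents the same vector \<open>(v, s k)\<close>, so its projection carries over
  unchanged.\<close>

lemma projectional_coderivative_subset_upper_outer: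
  fixes G :: "'a::euclidean_space \<times> 'b::euclidean_space \<Rightarrow> 'c::euclidean_space"
  assumes G: "C1_on UNIV G" and C: "closed (gph (mrestrict M (W \<times> UNIV)))"
    and cq: "basic_cq G M W wbar xbar"
  shows "projectional_coderivative W (sol_map G M) wbar xbar r \<subseteq> upper_outer G M W wbar xbar r"
proof
  let ?C = "gph (mrestrict M (W \<times> UNIV))" and ?E = "gph (mrestrict (sol_map G M) W)"
  let ?F' = "\<lambda>z. embed (frechet_derivative G (at z))"
  note G' = C1_on_frechet_derivative[OF G]
  have F': "(embed G has_derivative ?F' z) (at z)" for z
    by (rule has_derivative_embed[OF G'(1)])
  have cont: "continuous_on UNIV (\<lambda>z. ?F' z h)" for h
    unfolding embed_def by (intro continuous_on_Pair continuous_on_const continuous_on_minus G'(2))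
  fix t assume "t \<in> projectional_coderivative W (sol_map G M) wbar xbar r"
  then have "(t, - r) \<in> outer_limit ?E (wbar, xbar)
      (\<lambda>(w, x). proj_set (tangent_cone W w \<times> UNIV) (normal_cone ?E (w, x)))"
    unfolding projectional_coderivative_def by simp
  then obtain z p where z: "\<forall>k. z k \<in> ?E"
      "\<forall>k. p k \<in> (\<lambda>(w, x). proj_set (tangent_cone W w \<times> UNIV) (normal_cone ?E (w, x))) (z k)"
    and lim: "z \<longlonglongrightarrow> (wbar, xbar)" "p \<longlonglongrightarrow> (t, - r)"
    by (rule outer_limitE)
  have "eventually (\<lambda>z. \<forall>n\<in>normal_cone ?C (embed G z). adjoint (?F' z) n = 0 \<longrightarrow> n = 0) (nhds (wbar, xbar))"
    by (rule constraint_qualification_stable[OF F' cont C basic_cq_imp[OF G cq]])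
  from eventually_compose_filterlim[OF this lim(1)]
  obtain N where N: "\<And>k. k \<ge> N \<Longrightarrow> \<forall>n\<in>normal_cone ?C (embed G (z k)). adjoint (?F' (z k)) n = 0 \<longrightarrow> n = 0"
    unfolding eventually_sequentially by blast
  \<comment> \<open>The shift by N discards the terms at which the qualification may still
    fail.\<close>
  define w x t' s where "w k = fst (z (k + N))" and "x k = snd (z (k + N))"
    and "t' k = fst (p (k + N))" and "s k = snd (p (k + N))" for k
  have zk: "z (k + N) = (w k, x k)" and pk: "p (k + N) = (t' k, s k)" for k
    by (simp_all add: w_def x_def t'_def s_def)
  have lims: "w \<longlonglongrightarrow> wbar" "x \<longlonglongrightarrow> xbar" "t' \<longlonglongrightarrow> t" "s \<longlonglongrightarrow> - r"
    using tendsto_fst[OF LIMSEQ_ignore_initial_segment[OF lim(1), of N]]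
      tendsto_snd[OF LIMSEQ_ignore_initial_segment[OF lim(1), of N]]
      tendsto_fst[OF LIMSEQ_ignore_initial_segment[OF lim(2), of N]]
      tendsto_snd[OF LIMSEQ_ignore_initial_segment[OF lim(2), of N]]
    unfolding w_def[abs_def] x_def[abs_def] t'_def[abs_def] s_def[abs_def] by simp_all
  have "\<forall>k. \<exists>v y. (v, s k) \<in> normal_map G M W (w k) (x k) y \<and> t' k \<in> proj (tangent_cone W (w k)) v"
  proof
    fix k
    have "(t' k, s k) \<in> proj_set (tangent_cone W (w k) \<times> UNIV) (normal_cone ?E (w k, x k))"
      using z(2)[rule_format, of "k + N"] unfolding zk pk by simp
    then obtain v where v: "(v, s k) \<in> normal_cone (embed G -` ?C) (w k, x k)"
      "t' k \<in> proj (tangent_cone W (w k)) v"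
      unfolding proj_set_Times_UNIV gph_sol_map by blast
    have "\<exists>n \<in> normal_cone ?C (embed G (w k, x k)). (v, s k) = adjoint (?F' (w k, x k)) n"
    proof (rule normal_cone_chain_rule[OF F' cont C _ v(1)])
      show "n = 0" if "n \<in> normal_cone ?C (embed G (w k, x k))" "adjoint (?F' (w k, x k)) n = 0" for n
        using N[of "k + N"] that unfolding zk by simp
    qed blast
    then show "\<exists>v y. (v, s k) \<in> normal_map G M W (w k) (x k) y \<and> t' k \<in> proj (tangent_cone W (w k)) v"
      using v(2) unfolding normal_map_eq_adjoint_embed[OF G, symmetric] by blast
  qed
  then obtain v y where v: "\<And>k. (v k, s k) \<in> normal_map G M W (w k) (x k) (y k)"
    "\<And>k. t' k \<in> proj (tangent_cone W (w k)) (v k)"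
    by metis
  have E: "(w k, x k) \<in> ?E" for k using z(1)[rule_format, of "k + N"] unfolding zk .
  show "t \<in> upper_outer G M W wbar xbar r"
    unfolding mem_upper_outer using lims v E
    by (intro exI[of _ w] exI[of _ x] exI[of _ v] exI[of _ s] exI[of _ y] exI[of _ t'] conjI allI)
qed

section \<open>Bounded multipliers under the strong qualification\<close>

text \<open>Constant sequences suffice, as 0 is tangent to W at \<open>wbar\<close> and hence its
  own projection.\<close>

lemma strong_cq_imp_basic_cq:
  assumes E: "(wbar, xbar) \<in> gph (mrestrict (sol_map G M) W)" and cq: "strong_cq G M W wbar xbar"
  shows "basic_cq G M W wbar xbar"
  unfolding basic_cq_def
proof (intro allI impI)
  fix y assume y: "(0, 0) \<in> normal_map G M W wbar xbar y"
  have "wbar \<in> W" using E by (auto simp: gph_def mrestrict_def split: if_splits)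
  then have "0 \<in> proj (tangent_cone W wbar) 0" by (intro mem_proj_self zero_in_tangent_cone)
  with y E have "(0, 0) \<in> outer_limit (gph (mrestrict (sol_map G M) W) \<times> UNIV) ((wbar, xbar), y)
      (\<lambda>((w, x), y'). proj_set (tangent_cone W w \<times> UNIV) (normal_map G M W w x y'))"
    unfolding mem_outer_limit_normal_map
    by (intro exI[of _ "\<lambda>_. wbar"] exI[of _ "\<lambda>_. xbar"] exI[of _ "\<lambda>_. y"] exI[of _ "\<lambda>_. 0"] conjI allI tendsto_const)
  then show "y = 0" using cq unfolding strong_cq_def by blast
qed

text \<open>One inclusion only forgets that the multipliers converge. For the other, a subsequence
  of them has to be shown convergent.\<close>

lemma upper_outer_eq_upper_inner:
  fixes G :: "'a::euclidean_space \<times> 'b::euclidean_space \<Rightarrow> 'c::euclidean_space"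
  assumes G: "C1_on UNIV G" and cq: "strong_cq G M W wbar xbar"
  shows "upper_outer G M W wbar xbar r = upper_inner G M W wbar xbar r"
proof (intro equalityI subsetI)
  fix t assume "t \<in> upper_inner G M W wbar xbar r"
  then show "t \<in> upper_outer G M W wbar xbar r"
    unfolding upper_inner_eq[OF G] mem_outer_limit_normal_map mem_upper_outer mem_Collect_eq by blast
next
  let ?E = "gph (mrestrict (sol_map G M) W)"
  let ?A = "\<lambda>((w, x), y'). proj_set (tangent_cone W w \<times> UNIV) (normal_map G M W w x y')"
  fix t assume "t \<in> upper_outer G M W wbar xbar r"
  then obtain w x v s y t' where E: "\<And>k. (w k, x k) \<in> ?E"
    and v: "\<And>k. (v k, s k) \<in> normal_map G M W (w k) (x k) (y k)"
      "\<And>k. t' k \<in> proj (tangent_cone W (w k)) (v k)"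
    and lims: "w \<longlonglongrightarrow> wbar" "x \<longlonglongrightarrow> xbar" "t' \<longlonglongrightarrow> t" "s \<longlonglongrightarrow> - r"
    unfolding mem_upper_outer by blast
  obtain \<rho> l m where r: "strict_mono (\<rho> :: nat \<Rightarrow> nat)" "(\<lambda>k. inverse (1 + norm (y (\<rho> k)))) \<longlonglongrightarrow> l"
    "(\<lambda>k. inverse (1 + norm (y (\<rho> k))) *\<^sub>R y (\<rho> k)) \<longlonglongrightarrow> m"
    "0 \<le> l" "l = 0 \<longrightarrow> m \<noteq> 0" "l \<noteq> 0 \<longrightarrow> (\<lambda>k. y (\<rho> k)) \<longlonglongrightarrow> m /\<^sub>R l"
    by (rule normalized_subsequence[of y])
  have lims': "(\<lambda>k. w (\<rho> k)) \<longlonglongrightarrow> wbar" "(\<lambda>k. x (\<rho> k)) \<longlonglongrightarrow> xbar" "(\<lambda>k. t' (\<rho> k)) \<longlonglongrightarrow> t"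
    "(\<lambda>k. s (\<rho> k)) \<longlonglongrightarrow> - r"
    using lims[THEN LIMSEQ_subseq_LIMSEQ[OF _ r(1)]] by (simp_all add: o_def)
  \<comment> \<open>If l were 0, scaling would send \<open>t'\<close> and s to 0 while the scaled
    multipliers tend to \<open>m \<noteq> 0\<close>, against the strong qualification.\<close>
  have "l \<noteq> 0"
  proof
    assume l: "l = 0"
    define c where "c k = inverse (1 + norm (y (\<rho> k)))" for k
    have c: "0 < c k" for k by (simp add: c_def add_pos_nonneg)
    have "(\<lambda>k. c k *\<^sub>R t' (\<rho> k)) \<longlonglongrightarrow> l *\<^sub>R t" "(\<lambda>k. c k *\<^sub>R s (\<rho> k)) \<longlonglongrightarrow> l *\<^sub>R - r"
      unfolding c_def by (intro tendsto_scaleR r(2) lims')+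
    then have lim0: "(\<lambda>k. c k *\<^sub>R t' (\<rho> k)) \<longlonglongrightarrow> 0" "(\<lambda>k. c k *\<^sub>R s (\<rho> k)) \<longlonglongrightarrow> 0"
      by (simp_all add: l)
    have "(c k *\<^sub>R v (\<rho> k), c k *\<^sub>R s (\<rho> k)) \<in> normal_map G M W (w (\<rho> k)) (x (\<rho> k)) (c k *\<^sub>R y (\<rho> k))" for k
      using normal_map_scaleR[OF G v(1)[of "\<rho> k"] less_imp_le[OF c[of k]]] by simp
    moreover have "c k *\<^sub>R t' (\<rho> k) \<in> proj (tangent_cone W (w (\<rho> k))) (c k *\<^sub>R v (\<rho> k))" for k
      using tangent_cone_scaleR v(2) c by (rule proj_scaleR)
    ultimately have "(0, 0) \<in> outer_limit (?E \<times> UNIV) ((wbar, xbar), m) ?A"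
      unfolding mem_outer_limit_normal_map using E lims' r(3)[folded c_def] lim0
      by (intro exI[of _ "\<lambda>k. w (\<rho> k)"] exI[of _ "\<lambda>k. x (\<rho> k)"] exI[of _ "\<lambda>k. c k *\<^sub>R v (\<rho> k)"]
          exI[of _ "\<lambda>k. c k *\<^sub>R s (\<rho> k)"] exI[of _ "\<lambda>k. c k *\<^sub>R y (\<rho> k)"]
          exI[of _ "\<lambda>k. c k *\<^sub>R t' (\<rho> k)"] conjI allI)
    then have "m = 0" using cq unfolding strong_cq_def by blast
    then show False using r(5) l by simp
  qed
  then have y: "(\<lambda>k. y (\<rho> k)) \<longlonglongrightarrow> m /\<^sub>R l" using r(6) by simp
  have "(t, - r) \<in> outer_limit (?E \<times> UNIV) ((wbar, xbar), m /\<^sub>R l) ?A"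
    unfolding mem_outer_limit_normal_map using E v lims' y
    by (intro exI[of _ "\<lambda>k. w (\<rho> k)"] exI[of _ "\<lambda>k. x (\<rho> k)"] exI[of _ "\<lambda>k. v (\<rho> k)"]
        exI[of _ "\<lambda>k. s (\<rho> k)"] exI[of _ "\<lambda>k. y (\<rho> k)"] exI[of _ "\<lambda>k. t' (\<rho> k)"] conjI allI)
  then show "t \<in> upper_inner G M W wbar xbar r"
    unfolding upper_inner_eq[OF G] by blast
qed

section \<open>The exact formula for regular data on a smooth manifold\<close>

text \<open>Projected vectors are themselves in \<open>normal_map\<close>, which has closed graph,
  so the limit needs no control of the unprojected \<open>v k\<close>, which may be unbounded. The
  limit t is again tangent and thus its own projection.\<close>

lemma upper_inner_subset_proj:
  fixes G :: "(real ^ 'm) \<times> 'b::euclidean_space \<Rightarrow> 'c::euclidean_space"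
  assumes G: "C1_on UNIV G" and C: "closed (gph (mrestrict M (W \<times> UNIV)))"
    and W: "smooth_manifold_around d' W wbar" and t: "t \<in> upper_inner G M W wbar xbar r"
  shows "\<exists>y. (t, - r) \<in> proj_set (tangent_cone W wbar \<times> UNIV) (normal_map G M W wbar xbar y)"
proof -
  have wbar: "wbar \<in> W" using W by (simp add: smooth_manifold_around_def)
  obtain U and \<Phi>' :: "real ^ 'm \<Rightarrow> (real ^ 'm) \<Rightarrow>\<^sub>L (real ^ 'm)" where U: "open U" "wbar \<in> U" "continuous_on U \<Phi>'"
    and tan: "\<And>w. w \<in> W \<Longrightarrow> w \<in> U \<Longrightarrow> tangent_cone W w = {h. \<Phi>' w h = 0}"
    using smooth_manifold_tangent_cone[OF W] by blast
  obtain y w x v s y' t' where E: "\<And>k. (w k, x k) \<in> gph (mrestrict (sol_map G M) W)"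
    and v: "\<And>k. (v k, s k) \<in> normal_map G M W (w k) (x k) (y' k)"
      "\<And>k. t' k \<in> proj (tangent_cone W (w k)) (v k)"
    and lims: "w \<longlonglongrightarrow> wbar" "x \<longlonglongrightarrow> xbar" "y' \<longlonglongrightarrow> y" "t' \<longlonglongrightarrow> t" "s \<longlonglongrightarrow> - r"
    using t unfolding upper_inner_eq[OF G] mem_outer_limit_normal_map mem_Collect_eq by blast
  have "eventually (\<lambda>k. w k \<in> U) sequentially"
    using lims(1) U(1,2) by (rule topological_tendstoD)
  then obtain N where N: "\<And>k. k \<ge> N \<Longrightarrow> w k \<in> U"
    by (auto simp: eventually_sequentially)
  have wW: "w k \<in> W" for k using E[of k] by (auto simp: gph_def mrestrict_def split: if_splits)
  have t': "(t' k, s k) \<in> normal_map G M W (w k) (x k) (y' k) \<and> \<Phi>' (w k) (t' k) = 0" if "k \<ge> N" for k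
  proof
    let ?K = "{h. \<Phi>' (w k) h = 0}"
    have K: "tangent_cone W (w k) = ?K" by (rule tan[OF wW N[OF that]])
    show "\<Phi>' (w k) (t' k) = 0" using projD(1)[OF v(2)[of k]] K by simp
    \<comment> \<open>The residual of the projection is an adjoint image, exactly the kind of shift
      that \<open>normal_cone_add_adjoint\<close> permits.\<close>
    have "v k - t' k \<in> ?K\<^sup>\<bottom>"
      using v(2)[of k] K by (intro proj_subspace_orthogonal linear_subspace_kernel linear_blinfun_apply) simp
    then obtain m where "v k - t' k = adjoint (\<Phi>' (w k)) m"
      unfolding orthogonal_comp_kernel[OF linear_blinfun_apply] by blast
    then have m: "t' k = v k + adjoint (\<Phi>' (w k)) (- m)"
      using linear_neg[OF adjoint_linear[OF linear_blinfun_apply[of "\<Phi>' (w k)"]], of m]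
      by (simp add: algebra_simps)
    obtain a b where ab: "adjoint (frechet_derivative G (at (w k, x k))) (y' k) = (a, b)" by (metis surj_pair)
    have "((v k - a, s k - b), - y' k) \<in> normal_cone (gph (mrestrict M (W \<times> UNIV))) ((w k, x k), - G (w k, x k))"
      using v(1)[of k] by (simp add: mem_normal_map ab)
    then have "((v k - a + adjoint (\<Phi>' (w k)) (- m), s k - b), - y' k)
        \<in> normal_cone (gph (mrestrict M (W \<times> UNIV))) ((w k, x k), - G (w k, x k))"
      by (rule normal_cone_add_adjoint[OF _ U(1) N[OF that] U(3) _, rotated 2])
         (auto simp: gph_mrestrict_Times_UNIV tan)
    then show "(t' k, s k) \<in> normal_map G M W (w k) (x k) (y' k)"
      by (simp add: mem_normal_map ab m algebra_simps)
  qed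
  have "(t, - r) \<in> normal_map G M W wbar xbar y"
  proof (rule normal_map_closed_graph[OF G C])
    show "(t' (k + N), s (k + N)) \<in> normal_map G M W (w (k + N)) (x (k + N)) (y' (k + N))" for k
      using t' by simp
    show "(\<lambda>k. (t' (k + N), s (k + N))) \<longlonglongrightarrow> (t, - r)"
      by (intro tendsto_Pair LIMSEQ_ignore_initial_segment lims)
  qed (intro LIMSEQ_ignore_initial_segment lims)+
  moreover have "\<Phi>' wbar t = 0"
  proof -
    have "isCont \<Phi>' wbar" using U continuous_on_eq_continuous_at by blast
    from isCont_tendsto_compose[OF this lims(1)]
    have "(\<lambda>k. \<Phi>' (w k) (t' k)) \<longlonglongrightarrow> \<Phi>' wbar t" using lims(4) by (rule blinfun.tendsto)
    moreover have "eventually (\<lambda>k. \<Phi>' (w k) (t' k) = 0) sequentially"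
      using t' by (auto simp: eventually_sequentially)
    then have "(\<lambda>k. \<Phi>' (w k) (t' k)) \<longlonglongrightarrow> 0" by (rule tendsto_eventually)
    ultimately show ?thesis by (rule LIMSEQ_unique)
  qed
  then have "t \<in> proj (tangent_cone W wbar) t"
    using tan[OF wbar U(2)] by (intro mem_proj_self) simp
  ultimately show ?thesis unfolding proj_set_Times_UNIV by blast
qed

text \<open>Regularity turns the limiting normal n into a regular one, whose adjoint image is a
  regular normal to the preimage. Constant sequences then realize the outer limit.\<close>

lemma proj_subset_projectional_coderivative:
  fixes G :: "'a::euclidean_space \<times> 'b::euclidean_space \<Rightarrow> 'c::euclidean_space"
  assumes G: "C1_on UNIV G" and E: "(wbar, xbar) \<in> gph (mrestrict (sol_map G M) W)"
    and reg: "graphically_regular_at (mrestrict M (W \<times> UNIV)) (wbar, xbar) (- G (wbar, xbar))"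
    and t: "(t, - r) \<in> proj_set (tangent_cone W wbar \<times> UNIV) (normal_map G M W wbar xbar y)"
  shows "t \<in> projectional_coderivative W (sol_map G M) wbar xbar r"
proof -
  let ?C = "gph (mrestrict M (W \<times> UNIV))" and ?E = "gph (mrestrict (sol_map G M) W)"
  let ?F' = "embed (frechet_derivative G (at (wbar, xbar)))"
  obtain v where v: "(v, - r) \<in> normal_map G M W wbar xbar y" "t \<in> proj (tangent_cone W wbar) v"
    using t unfolding proj_set_Times_UNIV by blast
  then obtain n where n: "n \<in> normal_cone ?C (embed G (wbar, xbar))" "(v, - r) = adjoint ?F' n"
    using normal_map_eq_adjoint_embed[OF G, of "(v, - r)" M W wbar xbar] by blast
  have "n \<in> regular_normal_cone ?C (embed G (wbar, xbar))"
    using n(1) reg unfolding graphically_regular_at_def regular_at_def embed_def by simp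
  then have "(v, - r) \<in> regular_normal_cone ?E (wbar, xbar)"
    unfolding n(2) gph_sol_map
    by (rule regular_normal_cone_chain_rule[OF has_derivative_embed[OF C1_on_frechet_derivative(1)[OF G]]])
  then have "(v, - r) \<in> normal_cone ?E (wbar, xbar)" using regular_normal_cone_subset by blast
  then have p: "(t, - r) \<in> proj_set (tangent_cone W wbar \<times> UNIV) (normal_cone ?E (wbar, xbar))"
    using v(2) unfolding proj_set_Times_UNIV by blast
  show ?thesis
    unfolding projectional_coderivative_def mem_Collect_eq
    by (rule outer_limitI[where z = "\<lambda>_. (wbar, xbar)" and v = "\<lambda>_. (t, - r)"])
       (use E p in simp_all)
qed

theorem theorem3p4:
  fixes G :: "(real ^ 'm) \<times> (real ^ 'n) \<Rightarrow> real ^ 'd"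
    and M :: "(real ^ 'm) \<times> (real ^ 'n) \<Rightarrow> (real ^ 'd) set"
    and S :: "real ^ 'm \<Rightarrow> (real ^ 'n) set"
    and W :: "(real ^ 'm) set"
    and wbar :: "real ^ 'm" and xbar :: "real ^ 'n"
  assumes "C1_on UNIV G"
    and "closed (gph M)"
    and "S = sol_map G M"
    and "W \<subseteq> mdom S" and "closed W"
    and "(wbar, xbar) \<in> gph (mrestrict S W)"
  shows
    "(basic_cq G M W wbar xbar \<longrightarrow>
        (\<forall>r. projectional_coderivative W S wbar xbar r \<subseteq> upper_outer G M W wbar xbar r)) \<and>
     (strong_cq G M W wbar xbar \<longrightarrow>
        (\<forall>r. upper_outer G M W wbar xbar r = upper_inner G M W wbar xbar r \<and>
             projectional_coderivative W S wbar xbar r \<subseteq> upper_inner G M W wbar xbar r)) \<and>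
     (strong_cq G M W wbar xbar \<and>
      graphically_regular_at (mrestrict M (W \<times> UNIV)) (wbar, xbar) (- G (wbar, xbar)) \<and>
      (\<exists>d'. smooth_manifold_around d' W wbar) \<longrightarrow>
        (\<forall>r. projectional_coderivative W S wbar xbar r =
             {t. \<exists>y. (t, - r) \<in> proj_set (tangent_cone W wbar \<times> UNIV)
                                  (normal_map G M W wbar xbar y)}))"
proof -
  note G = assms(1)
  have C: "closed (gph (mrestrict M (W \<times> UNIV)))" by (rule closed_gph_mrestrict[OF assms(2,5)])
  have E: "(wbar, xbar) \<in> gph (mrestrict (sol_map G M) W)" using assms(3,6) by simp
  have 1: "projectional_coderivative W S wbar xbar r \<subseteq> upper_outer G M W wbar xbar r"
    if "basic_cq G M W wbar xbar" for r
    unfolding assms(3) by (rule projectional_coderivative_subset_upper_outer[OF G C that])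
  have 2: "upper_outer G M W wbar xbar r = upper_inner G M W wbar xbar r \<and>
      projectional_coderivative W S wbar xbar r \<subseteq> upper_inner G M W wbar xbar r"
    if "strong_cq G M W wbar xbar" for r
    using upper_outer_eq_upper_inner[OF G that] 1[OF strong_cq_imp_basic_cq[OF E that]] by simp
  \<comment> \<open>The inclusion from left to right passes through
    \<open>upper_inner\<close>.\<close>
  have 3: "projectional_coderivative W S wbar xbar r =
      {t. \<exists>y. (t, - r) \<in> proj_set (tangent_cone W wbar \<times> UNIV) (normal_map G M W wbar xbar y)}"
    if "strong_cq G M W wbar xbar"
      and "graphically_regular_at (mrestrict M (W \<times> UNIV)) (wbar, xbar) (- G (wbar, xbar))"
      and "smooth_manifold_around d' W wbar" for r d'
    using 2[OF that(1)] upper_inner_subset_proj[OF G C that(3)]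
      proj_subset_projectional_coderivative[OF G E that(2)] unfolding assms(3) by blast
  show ?thesis using 1 2 3 by blast
qed

end
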